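(* For every positive integer $\chi$ there are arbitrarily large positive integers $N$ for which there exist an $N$-vertex tournament $T$ and disjoint subsets $A, B \subseteq V(T)$ such that $\chi(T[A]) \geq \chi$, $\chi(T[B]) \geq \chi$, and the following holds: for all $A' \subseteq A$ and $B' \subseteq B$ each of size at most $\frac{\log N}{32\chi^2}$, both $\chi(T[A \cap N_T^+(B')]) \leq 2$ and $\chi(T[B \cap N_T^+(A')]) \leq 2$.
   Context: A tournament is an orientation of a finite complete graph. The chromatic number $\chi(T)$ of a tournament $T$ is the least $k$ for which there is a partition of $V(T)$ into $k$ parts each of which induces a transitive (acyclic) subtournament of $T$. $T[S]$ denotes the subtournament induced on a vertex set $S$. For a tournament $T$, $N_T^+(v)$ is the set of vertices $w$ such that $T$ has an arc from $v$ to $w$, and for a vertex set $U$, $N_T^+(U) = \bigcup_{v \in U} N_T^+(v)$. $\log$ denotes the natural logarithm. *)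

theory Defs
  imports Complex_Main "HOL-Library.Disjoint_Sets" "Graph_Theory.Digraph_Component"
begin

locale tournament = digraph G for G :: "('a, 'b) pre_digraph" (structure) +
  assumes exactly_one_arc:
    "\<lbrakk>u \<in> verts G; v \<in> verts G; u \<noteq> v\<rbrakk>
      \<Longrightarrow> (u, v) \<in> arcs_ends G \<longleftrightarrow> (v, u) \<notin> arcs_ends G"

definition transitive_digraph :: "('a, 'b) pre_digraph \<Rightarrow> bool" where
  "transitive_digraph G \<longleftrightarrow> trans (arcs_ends G)"

text \<open>The blocks of a \<^const>\<open>partition_on\<close> are nonempty, so the chromatic number of the
  null tournament is 0. For finite digraphs without loops the least element below always exists,
  see the last lemma.\<close>

definition chromatic_number :: "('a, 'b) pre_digraph \<Rightarrow> nat" where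
  "chromatic_number G =
    (LEAST k. \<exists>P. partition_on (verts G) P \<and> card P = k \<and>
                  (\<forall>S\<in>P. transitive_digraph (G \<restriction> S)))"

definition out_neighbours :: "('a, 'b) pre_digraph \<Rightarrow> 'a \<Rightarrow> 'a set" where
  "out_neighbours G v = {w. (v, w) \<in> arcs_ends G}"

definition out_neighbourhood :: "('a, 'b) pre_digraph \<Rightarrow> 'a set \<Rightarrow> 'a set" where
  "out_neighbourhood G U = (\<Union>v\<in>U. out_neighbours G v)"

lemma arcs_ends_induce_subgraph:
  "arcs_ends (G \<restriction> S) = arcs_ends G \<inter> S \<times> S"
  by (auto simp: arcs_ends_conv)

lemma (in tournament) tournament_induce_subgraph:
  assumes "S \<subseteq> verts G"
  shows "tournament (G \<restriction> S)"
proof -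
  have "finite S"
    using assms finite_verts by (rule finite_subset)
  then interpret S: digraph "G \<restriction> S"
    by unfold_locales (auto simp: no_loops no_multi_arcs)
  show ?thesis
  proof unfold_locales
    fix u v assume uv: "u \<in> verts (G \<restriction> S)" "v \<in> verts (G \<restriction> S)" and ne: "u \<noteq> v"
    then have "u \<in> verts G" "v \<in> verts G"
      using assms by auto
    from exactly_one_arc[OF this ne] uv
    show "(u, v) \<in> arcs_ends (G \<restriction> S) \<longleftrightarrow> (v, u) \<notin> arcs_ends (G \<restriction> S)"
      by (simp add: arcs_ends_induce_subgraph)
  qed
qed

lemma (in tournament) transitive_iff_acyclic:
  "transitive_digraph G \<longleftrightarrow> acyclic (arcs_ends G)"
proof
  assume "transitive_digraph G"
  then show "acyclic (arcs_ends G)"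
    using adj_not_same by (auto simp: transitive_digraph_def acyclic_def)
next
  assume acy: "acyclic (arcs_ends G)"
  show "transitive_digraph G"
    unfolding transitive_digraph_def
  proof (rule transI)
    fix u v w assume uv: "(u, v) \<in> arcs_ends G" and vw: "(v, w) \<in> arcs_ends G"
    have ne: "u \<noteq> w" and "(w, u) \<notin> arcs_ends G"
      using acy uv vw unfolding acyclic_def
      by (meson trancl.r_into_trancl trancl_into_trancl)+
    then show "(u, w) \<in> arcs_ends G"
      using exactly_one_arc[of u w] adj_in_verts[OF uv] adj_in_verts[OF vw] by blast
  qed
qed

lemma (in loopfree_digraph) chromatic_number_witness:
  obtains P where "partition_on (verts G) P" "card P = chromatic_number G"
    "\<And>S. S \<in> P \<Longrightarrow> transitive_digraph (G \<restriction> S)"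
proof -
  let ?Q = "\<lambda>k. \<exists>P. partition_on (verts G) P \<and> card P = k \<and>
                  (\<forall>S\<in>P. transitive_digraph (G \<restriction> S))"
  let ?P = "(\<lambda>v. {v}) ` verts G"
  have "partition_on (verts G) ?P"
    by (auto simp: partition_on_def disjoint_def)
  moreover have "\<forall>S\<in>?P. transitive_digraph (G \<restriction> S)"
    by (auto simp: transitive_digraph_def arcs_ends_induce_subgraph intro!: transI)
  ultimately have "?Q (card ?P)"
    by blast
  then have "?Q (chromatic_number G)"
    unfolding chromatic_number_def by (rule LeastI)
  then show ?thesis
    using that by blast
qed

end

theory Submission
  imports Defs "HOL-Library.Z2"
begin

text \<open>
  The sets \<open>A\<close> and \<open>B\<close> are two copies of a tournament that has a large chromatic number although it
  becomes 2-colourable when any one of \<open>n\<close> small sets is removed, where \<open>n\<close> is large.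

  This tournament comes from a graph. Its vertices are the sign vectors in \<open>{+,-,0}\<^sup>n\<close> that have an
  alternating subsequence of length at least \<open>n - d\<close>, with \<open>d = 2 * k - 2\<close>. Two vectors are adjacent
  if no coordinate has the same nonzero sign in both. The chromatic number is at least
  \<open>d + 2 = 2 * k\<close> by Tucker's lemma (\<open>near_alternating_chromatic\<close>), which is derived from Fan's
  parity argument for chains of sign vectors (\<open>Fan_parity\<close>). For each coordinate \<open>i\<close>, the
  vectors that are nonzero at \<open>i\<close> induce a bipartite graph, since the sign at \<open>i\<close> is a proper
  colouring. Each vector has at most \<open>d\<close> zeros, and there are at most \<open>2 * (3 * n + 1) ^ d\<close> of
  them. Orient the complete graph on the vertices such that the back edges with respect to some
  linear order are the edges of the graph. A proper colouring of the graph is then a partition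
  into transitive parts, and as the graph is triangle-free, each transitive part is bipartite in the
  graph (\<open>triangle_free_back_edge_colouring\<close>). So the tournament has chromatic number at least \<open>k\<close>,
  while the vectors that are nonzero at \<open>i\<close> have chromatic number at most 2.

  It remains to orient the pairs between \<open>A\<close> and \<open>B\<close> such that, for each \<open>B'\<close> of at most \<open>t\<close> vertices,
  some coordinate \<open>i\<close> has the property that all \<open>a \<in> A\<close> that are zero at \<open>i\<close> have arcs to all of \<open>B'\<close>;
  then \<open>A \<inter> N\<^sup>+(B')\<close> consists of vectors that are nonzero at \<open>i\<close>. Take an \<open>n \<times> n\<close> bit matrix \<open>w\<close> and
  put an arc from \<open>a\<close> to \<open>b\<close> if \<open>a\<close> has a zero \<open>i\<close> such that \<open>w i j\<close> holds for all zeros \<open>j\<close> of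
  \<open>b\<close>. The vertices in \<open>B'\<close> have at most \<open>s = t * d\<close> zeros together, so it suffices that any \<open>s\<close>
  columns have a row that is true on all of them. The condition for \<open>A'\<close> is symmetric: any \<open>s\<close>
  rows have a column that is false on all of them. A random matrix of size \<open>n = 2 ^ (2 * s + 3)\<close> has
  both properties (\<open>exists_universal_bit_matrix\<close>). The number of vertices is then 2 to the power
  \<open>O(s * d) = O(k\<^sup>2 * t)\<close>, and the remaining vertices of the tournament are padding.
\<close>

section \<open>Sign vectors\<close>

text \<open>A vector in \<open>{+,-,0}\<^sup>n\<close> is encoded by the graph of its sign function, the set of the pairs
  \<open>(i, b)\<close> such that the coordinate \<open>i\<close> has the sign \<open>b\<close>; a coordinate that does not occur
  is zero. Extending a vector by further nonzero coordinates is then set inclusion, and two vectors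
  are disjoint as sets if and only if no coordinate has the same nonzero sign in both.\<close>

definition antipode :: "(nat \<times> bool) set \<Rightarrow> (nat \<times> bool) set" where
  "antipode X = map_prod id Not ` X"

definition sign_vector :: "nat \<Rightarrow> (nat \<times> bool) set \<Rightarrow> bool" where
  "sign_vector n X \<longleftrightarrow> X \<subseteq> {..<n} \<times> UNIV \<and> inj_on fst X"

lemma mem_antipode [simp]: "(i, b) \<in> antipode X \<longleftrightarrow> (i, \<not> b) \<in> X"
  by (force simp: antipode_def map_prod_def)

lemma antipode_antipode [simp]: "antipode (antipode X) = X"
  by auto

lemma sign_vector_iff:
  "sign_vector n X \<longleftrightarrow> (\<forall>i b. (i, b) \<in> X \<longrightarrow> i < n \<and> (i, \<not> b) \<notin> X)"
proof -
  have "inj_on fst X \<longleftrightarrow> (\<forall>i b. (i, b) \<in> X \<longrightarrow> (i, \<not> b) \<notin> X)"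
  proof
    assume inj: "inj_on fst X"
    then show "\<forall>i b. (i, b) \<in> X \<longrightarrow> (i, \<not> b) \<notin> X"
      by (metis fst_conv inj_on_def snd_conv)
  next
    assume *: "\<forall>i b. (i, b) \<in> X \<longrightarrow> (i, \<not> b) \<notin> X"
    show "inj_on fst X"
    proof (rule inj_onI)
      fix x y assume xy: "x \<in> X" "y \<in> X" "fst x = fst y"
      obtain i b where x: "x = (i, b)" by (cases x)
      then obtain c where y: "y = (i, c)" using xy(3) by (cases y) auto
      show "x = y"
        using *[rule_format, of i True] xy(1,2) unfolding x y by (cases b; cases c) auto
    qed
  qed
  then show ?thesis
    unfolding sign_vector_def by auto
qed

lemma sign_vector_antipode [simp]: "sign_vector n (antipode X) \<longleftrightarrow> sign_vector n X"
  unfolding sign_vector_iff mem_antipode by (auto simp: all_bool_eq)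

lemma sign_vector_subset: "sign_vector n Y \<Longrightarrow> X \<subseteq> Y \<Longrightarrow> sign_vector n X"
  unfolding sign_vector_def by (meson inj_on_subset subset_trans)

lemma sign_vector_less: "sign_vector n X \<Longrightarrow> (i, b) \<in> X \<Longrightarrow> i < n"
  unfolding sign_vector_def by auto

lemma sign_vector_unique: "sign_vector n X \<Longrightarrow> (i, b) \<in> X \<Longrightarrow> (i, c) \<in> X \<Longrightarrow> b = c"
  unfolding sign_vector_def by (metis fst_conv inj_onD snd_conv)

section \<open>Alternating labels\<close>

text \<open>Tucker's lemma concerns labels that consist of a level \<open>j\<close> and a sign. They are encoded by
  natural numbers: \<open>2 * j\<close> stands for \<open>+j\<close> and \<open>2 * j + 1\<close> for \<open>-j\<close>. The sign of a label is its parity, and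
  as long as a set does not contain both \<open>+j\<close> and \<open>-j\<close> for some \<open>j\<close>, its natural order is
  the order by levels.\<close>

primrec alternating :: "bool \<Rightarrow> nat list \<Rightarrow> bool" where
  "alternating s [] \<longleftrightarrow> True"
| "alternating s (x # xs) \<longleftrightarrow> (even x \<longleftrightarrow> s) \<and> alternating (\<not> s) xs"

text \<open>If the deletion of a single entry makes the list alternate from \<open>s\<close>, and the list itself does
  not alternate from either sign, then the list has exactly one pair of equal adjacent signs, and
  deleting either of the two works. A list that alternates from \<open>s\<close> can only lose its last entry,
  one that alternates from \<open>\<not> s\<close> only its first.\<close>

lemma alternating_remove1_parity:
  assumes "distinct xs"
  shows "even (card {x \<in> set xs. alternating s (remove1 x xs)}
    + of_bool (alternating s xs) + of_bool (alternating (\<not> s) xs) :: nat)"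
  using assms
proof (induction xs arbitrary: s)
  case Nil
  then show ?case by simp
next
  case (Cons a xs)
  let ?B = "{x \<in> set xs. alternating (\<not> s) (remove1 x xs)}"
  have "{x \<in> set (a # xs). alternating s (remove1 x (a # xs))}
      = (if alternating s xs then {a} else {}) \<union> (if even a = s then ?B else {})"
    using Cons.prems by auto
  moreover have "a \<notin> ?B" "finite ?B"
    using Cons.prems by auto
  ultimately have *: "card {x \<in> set (a # xs). alternating s (remove1 x (a # xs))}
      = of_bool (alternating s xs) + (if even a = s then card ?B else 0)"
    by (auto simp: card_insert_if)
  have IH: "even (card ?B + of_bool (alternating (\<not> s) xs) + of_bool (alternating s xs) :: nat)"
    using Cons.IH[of "\<not> s"] Cons.prems by simp
  show ?case
    unfolding * using IH by (cases "even a = s") auto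
qed

text \<open>Injectivity is part of the definition because \<open>sorted_list_of_set\<close> forgets repetitions: a simplex
  in which a label occurs twice does not count as alternating.\<close>

definition alternates_on :: "bool \<Rightarrow> ('i \<Rightarrow> nat) \<Rightarrow> 'i set \<Rightarrow> bool" where
  "alternates_on s f I \<longleftrightarrow> inj_on f I \<and> alternating s (sorted_list_of_set (f ` I))"

lemma alternates_on_cong:
  "(\<And>i. i \<in> I \<Longrightarrow> f i = g i) \<Longrightarrow> alternates_on s f I \<longleftrightarrow> alternates_on s g I"
  unfolding alternates_on_def by (metis image_cong inj_on_cong)

text \<open>This is the coboundary relation of Fan's argument: \<open>I\<close> is a simplex, and the sets \<open>I - {i}\<close> are
  its facets. If two vertices have the same label, only the facets opposite these two vertices can
  alternate, and they have the same labels; otherwise the claim is the one about lists.\<close>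

lemma alternates_on_facet_parity:
  assumes "finite I"
  shows "even (card {i \<in> I. alternates_on s f (I - {i})}
    + of_bool (alternates_on s f I) + of_bool (alternates_on (\<not> s) f I) :: nat)"
proof (cases "inj_on f I")
  case True
  let ?xs = "sorted_list_of_set (f ` I)"
  have "f ` {i \<in> I. alternates_on s f (I - {i})} = {x \<in> set ?xs. alternating s (remove1 x ?xs)}"
  proof -
    have "alternates_on s f (I - {i}) \<longleftrightarrow> alternating s (remove1 (f i) ?xs)" if "i \<in> I" for i
    proof -
      have "f ` (I - {i}) = f ` I - {f i}"
        using True that by (auto simp: inj_on_def)
      moreover have "inj_on f (I - {i})"
        using True by (rule inj_on_subset) auto
      ultimately show ?thesis
        using assms by (simp add: alternates_on_def sorted_list_of_set_remove)
    qed
    then show ?thesis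
      using assms by auto
  qed
  moreover have "inj_on f {i \<in> I. alternates_on s f (I - {i})}"
    using True by (rule inj_on_subset) auto
  ultimately have "card {i \<in> I. alternates_on s f (I - {i})}
      = card {x \<in> set ?xs. alternating s (remove1 x ?xs)}"
    using card_image[of f "{i \<in> I. alternates_on s f (I - {i})}"] by simp
  then show ?thesis
    using alternating_remove1_parity[of ?xs s] True by (simp add: alternates_on_def)
next
  case False
  then obtain p q where pq: "p \<in> I" "q \<in> I" "p \<noteq> q" "f p = f q"
    by (auto simp: inj_on_def)
  have sub: "{i \<in> I. alternates_on s f (I - {i})} \<subseteq> {p, q}"
    using pq by (auto simp: alternates_on_def inj_on_def)
  have img: "f ` (I - {p}) = f ` (I - {q})"
  proof -
    have "f ` (I - {p}) = f ` I" if "p \<in> I" "q \<in> I" "p \<noteq> q" "f p = f q" for p q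
    proof
      show "f ` I \<subseteq> f ` (I - {p})"
      proof
        fix y assume "y \<in> f ` I"
        then obtain i where "i \<in> I" "y = f i" by blast
        then have "y = f (if i = p then q else i)" "(if i = p then q else i) \<in> I - {p}"
          using that by auto
        then show "y \<in> f ` (I - {p})" by blast
      qed
    qed auto
    from this[OF pq] this[OF pq(2,1) pq(3)[symmetric] pq(4)[symmetric]] show ?thesis
      by simp
  qed
  have inj: "inj_on f (I - {p}) \<longleftrightarrow> inj_on f (I - {q})"
  proof -
    have "card (I - {p}) = card (I - {q})"
      using pq by (simp add: card_Diff_singleton)
    then show ?thesis
      using img inj_on_iff_eq_card[of "I - {p}" f] inj_on_iff_eq_card[of "I - {q}" f] assms by simp
  qed
  have "alternates_on s f (I - {p}) \<longleftrightarrow> alternates_on s f (I - {q})"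
    using img inj by (simp add: alternates_on_def)
  define F where "F = {i \<in> I. alternates_on s f (I - {i})}"
  have "F = {} \<or> F = {p, q}"
    using \<open>alternates_on s f (I - {p}) \<longleftrightarrow> alternates_on s f (I - {q})\<close> sub pq
    unfolding F_def by blast
  then have "even (card F)"
    using pq by auto
  then show ?thesis
    using False by (simp add: alternates_on_def F_def)
qed

lemma even_card_involution:
  assumes "\<And>x. x \<in> S \<Longrightarrow> f x \<in> S" "\<And>x. x \<in> S \<Longrightarrow> f (f x) = x"
    "\<And>x. x \<in> S \<Longrightarrow> f x \<noteq> x"
  shows "even (card S)"
proof -
  have "(\<Sum>x\<in>S. 1 :: bit) = 0"
    by (rule sum_involution_eq_0[where h = f]) (use assms in auto)
  then have "even (of_nat (card S) :: bit)"
    by simp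
  then show ?thesis
    by (simp only: even_of_nat_iff)
qed

section \<open>Fan's lemma and Tucker's lemma\<close>

text \<open>The encoding of the change of sign at a fixed level.\<close>

definition flip :: "nat \<Rightarrow> nat" where
  "flip l = (if even l then Suc l else l - 1)"

lemma flip_flip [simp]: "flip (flip l) = l"
  by (auto simp: flip_def)

lemma even_flip [simp]: "even (flip l) \<longleftrightarrow> odd l"
  by (auto simp: flip_def)

lemma flip_strict_mono: "a < b \<Longrightarrow> b \<noteq> flip a \<Longrightarrow> flip a < flip b"
  unfolding flip_def by (auto split: if_splits) presburger+

lemma alternating_map_flip: "alternating s (map flip xs) \<longleftrightarrow> alternating (\<not> s) xs"
  by (induction xs arbitrary: s) auto

text \<open>Only for a set without complementary labels does changing all signs preserve the order of the
  codes; on \<open>{2 * j, 2 * j + 1}\<close> it would swap the two.\<close>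

lemma alternates_on_flip:
  assumes "finite I" and compl: "\<And>i j. i \<in> I \<Longrightarrow> j \<in> I \<Longrightarrow> f j \<noteq> flip (f i)"
  shows "alternates_on s (\<lambda>i. flip (f i)) I \<longleftrightarrow> alternates_on (\<not> s) f I"
proof -
  let ?xs = "sorted_list_of_set (f ` I)"
  have "sorted_list_of_set (flip ` f ` I) = map flip ?xs"
  proof (rule strict_sorted_equal)
    have "sorted_wrt (\<lambda>a b. flip a < flip b) ?xs"
    proof (rule sorted_wrt_mono_rel[OF _ strict_sorted_list_of_set])
      fix a b assume "a \<in> set ?xs" "b \<in> set ?xs" "a < b"
      then show "flip a < flip b"
        using assms by (intro flip_strict_mono) auto
    qed
    then show "sorted_wrt (<) (map flip ?xs)"
      by (simp add: sorted_wrt_map)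
  qed (use assms(1) in auto)
  moreover have "inj_on (\<lambda>i. flip (f i)) I \<longleftrightarrow> inj_on f I"
    unfolding inj_on_def by (metis flip_flip)
  ultimately show ?thesis
    by (simp add: alternates_on_def alternating_map_flip image_image)
qed

text \<open>A signed order lists the coordinates in the order in which they become nonzero, together with their
  signs. Its nonempty prefixes form a maximal chain of nonzero sign vectors, and every maximal chain
  arises exactly once. So these lists are the facets of the barycentric subdivision of the boundary
  of the \<open>n\<close>-dimensional cross-polytope.\<close>

definition signed_orders :: "nat \<Rightarrow> (nat \<times> bool) list set" where
  "signed_orders n = {xs. distinct (map fst xs) \<and> fst ` set xs = {..<n}}"

lemma signed_orders_length: "xs \<in> signed_orders n \<Longrightarrow> length xs = n"
  unfolding signed_orders_def by (metis (mono_tags, lifting) card_lessThan distinct_card length_map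
      list.set_map mem_Collect_eq)

lemma finite_signed_orders: "finite (signed_orders n)"
proof -
  have "signed_orders n \<subseteq> {xs. set xs \<subseteq> {..<n} \<times> UNIV \<and> length xs = n}"
  proof
    fix xs assume xs: "xs \<in> signed_orders n"
    have "set xs \<subseteq> fst ` set xs \<times> UNIV" by force
    then show "xs \<in> {xs. set xs \<subseteq> {..<n} \<times> UNIV \<and> length xs = n}"
      using xs signed_orders_length[OF xs] by (simp add: signed_orders_def)
  qed
  then show ?thesis
    by (rule finite_subset) (intro finite_lists_length_eq finite_SigmaI; simp)
qed

lemma signed_orders_sign_vector:
  "xs \<in> signed_orders n \<Longrightarrow> sign_vector n (set (take i xs))"
proof -
  assume xs: "xs \<in> signed_orders n"
  have "sign_vector n (set xs)"
    using xs unfolding signed_orders_def sign_vector_def by (force simp: distinct_map)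
  then show ?thesis
    by (rule sign_vector_subset) (rule set_take_subset)
qed

definition chain_label :: "((nat \<times> bool) set \<Rightarrow> nat) \<Rightarrow> (nat \<times> bool) list \<Rightarrow> nat \<Rightarrow> nat" where
  "chain_label L xs i = L (set (take (Suc i) xs))"

text \<open>Leaving out the vertex \<open>i\<close> of a chain gives a face of codimension one, which lies in exactly two
  maximal chains. They differ by a transposition of the entries \<open>i\<close> and \<open>Suc i\<close> if the vertex is
  not the last one, and by the sign of the last entry if it is.\<close>

definition transpose_at :: "nat \<Rightarrow> 'a list \<Rightarrow> 'a list" where
  "transpose_at i xs = xs[i := xs ! Suc i, Suc i := xs ! i]"

lemma transpose_at:
  assumes "Suc i < length xs"
  shows "set (transpose_at i xs) = set xs" "transpose_at i (transpose_at i xs) = xs"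
    "distinct xs \<Longrightarrow> transpose_at i xs \<noteq> xs"
    "distinct (map f (transpose_at i xs)) \<longleftrightarrow> distinct (map f xs)"
    "j \<noteq> i \<Longrightarrow> set (take (Suc j) (transpose_at i xs)) = set (take (Suc j) xs)"
proof -
  show "set (transpose_at i xs) = set xs"
    using assms unfolding transpose_at_def by (intro set_swap) auto
  show "transpose_at i (transpose_at i xs) = xs"
    using assms unfolding transpose_at_def by (intro nth_equalityI) (auto simp: nth_list_update)
  show "transpose_at i xs \<noteq> xs" if "distinct xs"
  proof
    assume "transpose_at i xs = xs"
    then have "transpose_at i xs ! i = xs ! i" by simp
    then show False
      using assms that by (simp add: transpose_at_def nth_list_update nth_eq_iff_index_eq)
  qed
  have "map f (transpose_at i xs) = (map f xs)[i := map f xs ! Suc i, Suc i := map f xs ! i]"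
    using assms by (simp add: transpose_at_def map_update)
  then show "distinct (map f (transpose_at i xs)) \<longleftrightarrow> distinct (map f xs)"
    using assms distinct_swap[of i "map f xs" "Suc i"] by simp
  show "set (take (Suc j) (transpose_at i xs)) = set (take (Suc j) xs)" if "j \<noteq> i"
  proof (cases "j < i")
    case True
    then show ?thesis
      by (simp add: transpose_at_def take_update_swap list_update_beyond)
  next
    case False
    then have "i < j" using that by simp
    then have "take (Suc j) (transpose_at i xs)
        = (take (Suc j) xs)[i := take (Suc j) xs ! Suc i, Suc i := take (Suc j) xs ! i]"
      by (simp add: transpose_at_def take_update_swap)
    then show ?thesis
      using assms \<open>i < j\<close> set_swap[of i "take (Suc j) xs" "Suc i"] by simp
  qed
qed

lemma transpose_at_signed_orders:
  "Suc i < n \<Longrightarrow> xs \<in> signed_orders n \<Longrightarrow> transpose_at i xs \<in> signed_orders n"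
  using transpose_at(1)[of i xs] transpose_at(4)[of i xs fst] signed_orders_length[of xs n]
  by (simp add: signed_orders_def)

definition negate_at :: "nat \<Rightarrow> (nat \<times> bool) list \<Rightarrow> (nat \<times> bool) list" where
  "negate_at i xs = xs[i := map_prod id Not (xs ! i)]"

lemma negate_at:
  assumes "i < length xs"
  shows "map fst (negate_at i xs) = map fst xs" "negate_at i (negate_at i xs) = xs"
    "negate_at i xs \<noteq> xs"
proof -
  show "map fst (negate_at i xs) = map fst xs"
    using assms by (intro nth_equalityI) (auto simp: negate_at_def nth_list_update)
  show "negate_at i (negate_at i xs) = xs"
    using assms by (intro nth_equalityI)
      (auto simp: negate_at_def nth_list_update map_prod_def split: prod.splits)
  show "negate_at i xs \<noteq> xs"
  proof
    assume "negate_at i xs = xs"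
    then have "negate_at i xs ! i = xs ! i" by simp
    then show False
      using assms by (cases "xs ! i") (simp add: negate_at_def)
  qed
qed

lemma negate_at_signed_orders:
  "i < n \<Longrightarrow> xs \<in> signed_orders n \<Longrightarrow> negate_at i xs \<in> signed_orders n"
  using negate_at(1)[of i xs] signed_orders_length[of xs n]
  unfolding signed_orders_def by (metis (mono_tags, lifting) list.set_map mem_Collect_eq)

definition positive_chains :: "((nat \<times> bool) set \<Rightarrow> nat) \<Rightarrow> nat \<Rightarrow> (nat \<times> bool) list set" where
  "positive_chains L n = {xs \<in> signed_orders n. alternates_on True (chain_label L xs) {..<n}}"

text \<open>Fan's combinatorial lemma for the subdivided cross-polytope, by induction on the dimension. The
  upper hemisphere \<open>U\<close> consists of the chains in which the last coordinate finally gets the sign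
  \<open>+\<close>. The incidences between its chains and their positively alternating faces of codimension one
  are counted in two ways. For each face, there are two incidences, unless the face lies in the
  boundary of \<open>U\<close>; this boundary is the sphere of one dimension less, for which the induction
  hypothesis gives an odd number. For each chain, the number of incidences is odd if and only if the
  chain itself alternates, from either sign. The antipode maps the negatively alternating chains of
  \<open>U\<close> to the positively alternating ones of the lower hemisphere, so the alternating chains of
  \<open>U\<close> are as many as the positively alternating chains of the whole sphere.\<close>

theorem Fan_parity:
  assumes "\<And>X. sign_vector n X \<Longrightarrow> X \<noteq> {} \<Longrightarrow> L (antipode X) = flip (L X)"
    and "\<And>X Y. sign_vector n Y \<Longrightarrow> X \<noteq> {} \<Longrightarrow> X \<subseteq> Y \<Longrightarrow> L Y \<noteq> flip (L X)"
  shows "odd (card (positive_chains L n))"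
  using assms
proof (induction n)
  case 0
  have "positive_chains L 0 = {[]}"
    by (auto simp: positive_chains_def signed_orders_def alternates_on_def)
  then show ?case by simp
next
  case (Suc n)
  have sv: "sign_vector (Suc n) X" if "sign_vector n X" for X
    using that unfolding sign_vector_def by auto
  have IH: "odd (card (positive_chains L n))"
    using Suc.prems sv by (intro Suc.IH) blast+
  let ?f = "chain_label L"
  let ?e = "(n, True)"
  define U where "U = {xs \<in> signed_orders (Suc n). ?e \<in> set xs}"
  \<comment> \<open>\<open>P\<close> is the set of incidences; \<open>F\<close> consists of those whose face lies in the boundary of \<open>U\<close>,
    and \<open>h\<close> passes to the other chain that contains the same face.\<close>
  define P where "P = (SIGMA xs:U. {i \<in> {..<Suc n}. alternates_on True (?f xs) ({..<Suc n} - {i})})"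
  define F where "F = {p \<in> P. snd p = n \<and> fst p ! n = ?e}"
  define h where "h = (\<lambda>(xs, i). (if i < n then transpose_at i xs else negate_at n xs, i))"
  have finU: "finite U"
    unfolding U_def using finite_signed_orders by auto
  have finP: "finite P"
    unfolding P_def by (intro finite_SigmaI finU) auto
  have len: "length xs = Suc n" if "xs \<in> U" for xs
    using that signed_orders_length unfolding U_def by blast
  have hU: "h (xs, i) \<in> P - F \<and> h (h (xs, i)) = (xs, i) \<and> h (xs, i) \<noteq> (xs, i)"
    if p: "(xs, i) \<in> P - F" for xs i
  proof -
    have xs: "xs \<in> U" and i: "i \<le> n" and alt: "alternates_on True (?f xs) ({..<Suc n} - {i})"
      and nF: "\<not> (i = n \<and> xs ! n = ?e)"
      using p unfolding P_def F_def by auto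
    have so: "xs \<in> signed_orders (Suc n)" and e: "?e \<in> set xs" and d: "distinct (map fst xs)"
      using xs unfolding U_def signed_orders_def by auto
    show ?thesis
    proof (cases "i < n")
      case True
      then have l: "Suc i < length xs"
        using len[OF xs] by simp
      have "transpose_at i xs \<in> U"
        using transpose_at_signed_orders[OF _ so, of i] transpose_at(1)[OF l] True e
        unfolding U_def by simp
      moreover have "alternates_on True (?f (transpose_at i xs)) ({..<Suc n} - {i})"
        using alt by (subst alternates_on_cong[where g = "?f xs"])
          (auto simp: chain_label_def transpose_at(5)[OF l])
      ultimately show ?thesis
        using True transpose_at(2,3)[OF l] d[unfolded distinct_map]
        unfolding P_def F_def h_def by auto
    next
      case False
      then have i: "i = n" using i by simp
      have l: "n < length xs"
        using len[OF xs] by simp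
      obtain j where j: "j < Suc n" "xs ! j = ?e"
        using e len[OF xs] by (metis in_set_conv_nth)
      then have "j < n"
        using nF i by (metis less_antisym)
      then have nj: "negate_at n xs ! j = ?e"
        using j by (simp add: negate_at_def)
      then have "?e \<in> set (negate_at n xs)"
        using \<open>j < n\<close> l by (metis length_list_update less_trans negate_at_def nth_mem)
      then have nU: "negate_at n xs \<in> U"
        using negate_at_signed_orders[OF _ so, of n] unfolding U_def by simp
      have "negate_at n xs ! n \<noteq> ?e"
      proof
        assume eq: "negate_at n xs ! n = ?e"
        have "distinct (map fst (negate_at n xs))"
          using d negate_at(1)[OF l] by simp
        then have "distinct (negate_at n xs)"
          by (simp add: distinct_map)
        then show False
          using eq nj \<open>j < n\<close> len[OF nU] nth_eq_iff_index_eq[of "negate_at n xs" n j] by simp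
      qed
      moreover have "alternates_on True (?f (negate_at n xs)) ({..<Suc n} - {n})"
        using alt unfolding i by (subst alternates_on_cong[where g = "?f xs"])
          (auto simp: chain_label_def negate_at_def take_update_swap list_update_beyond)
      ultimately show ?thesis
        using negate_at(2,3)[OF l] nU unfolding i P_def F_def h_def by auto
    qed
  qed
  have "even (card (P - F))"
    by (rule even_card_involution[where f = h]) (use hU in auto)
  moreover have "card F = card (positive_chains L n)"
  proof -
    let ?g = "\<lambda>ys. (ys @ [?e], n)"
    have "F = ?g ` positive_chains L n"
    proof (intro equalityI subsetI)
      fix p assume "p \<in> F"
      then obtain xs where p: "p = (xs, n)" and xs: "xs \<in> U" "xs ! n = ?e"
        and alt: "alternates_on True (?f xs) ({..<Suc n} - {n})"
        unfolding F_def P_def by auto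
      define ys where "ys = take n xs"
      have xs_eq: "xs = ys @ [?e]"
        using len[OF xs(1)] xs(2) unfolding ys_def
        by (metis lessI order_refl take_Suc_conv_app_nth take_all)
      have ly: "length ys = n"
        using len[OF xs(1)] unfolding ys_def by simp
      have so: "distinct (map fst ys)" "n \<notin> fst ` set ys" "insert n (fst ` set ys) = {..<Suc n}"
        using xs(1) unfolding U_def signed_orders_def xs_eq by auto
      then have "fst ` set ys = {..<n}"
        by (metis Diff_insert_absorb insert_absorb lessThan_Suc lessThan_iff less_irrefl)
      then have "ys \<in> signed_orders n"
        using so(1) by (simp add: signed_orders_def)
      moreover have "alternates_on True (?f ys) {..<n}"
      proof -
        have "alternates_on True (?f xs) {..<n}"
          using alt by (simp add: lessThan_Suc)
        then show ?thesis
          by (subst alternates_on_cong[where g = "?f xs"]) (auto simp: chain_label_def xs_eq ly)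
      qed
      ultimately show "p \<in> ?g ` positive_chains L n"
        unfolding positive_chains_def p xs_eq by auto
    next
      fix p assume "p \<in> ?g ` positive_chains L n"
      then obtain ys where p: "p = (ys @ [?e], n)" and ys: "ys \<in> signed_orders n"
        and alt: "alternates_on True (?f ys) {..<n}"
        unfolding positive_chains_def by auto
      have ly: "length ys = n"
        using ys by (rule signed_orders_length)
      have "ys @ [?e] \<in> U"
        using ys unfolding U_def signed_orders_def by (auto simp: lessThan_Suc)
      moreover have "alternates_on True (?f (ys @ [?e])) ({..<Suc n} - {n})"
      proof -
        have "{..<Suc n} - {n} = {..<n}" by auto
        then show ?thesis
          using alt by (subst alternates_on_cong[where g = "?f ys"]) (auto simp: chain_label_def ly)
      qed
      ultimately show "p \<in> F"
        unfolding F_def P_def p using ly by (auto simp: nth_append)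
    qed
    moreover have "inj_on ?g (positive_chains L n)"
      by (auto intro: inj_onI)
    ultimately show ?thesis
      by (simp add: card_image)
  qed
  moreover have "card P = card (P - F) + card F"
    using finP by (metis (no_types, lifting) F_def add.commute card_Diff_subset card_mono
        finite_subset le_add_diff_inverse mem_Collect_eq subsetI)
  ultimately have oddP: "odd (card P)"
    using IH by simp
  define Upos Uneg where "Upos = {xs \<in> U. alternates_on True (?f xs) {..<Suc n}}"
    and "Uneg = {xs \<in> U. alternates_on False (?f xs) {..<Suc n}}"
  have "even (card P + card Upos + card Uneg)"
  proof -
    let ?c = "\<lambda>xs. card {i \<in> {..<Suc n}. alternates_on True (?f xs) ({..<Suc n} - {i})}"
    let ?a = "\<lambda>s xs. of_bool (alternates_on s (?f xs) {..<Suc n}) :: nat"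
    have cnt: "card {xs \<in> U. Q xs} = (\<Sum>xs\<in>U. of_bool (Q xs) :: nat)" for Q
      using finU by (simp add: Int_def)
    have "card P + card Upos + card Uneg = (\<Sum>xs\<in>U. (?c xs + ?a True xs + ?a False xs))"
      unfolding P_def Upos_def Uneg_def cnt sum.distrib by (subst card_SigmaI[OF finU]) auto
    moreover have "even (\<Sum>xs\<in>U. (?c xs + ?a True xs + ?a False xs))"
      using alternates_on_facet_parity[of "{..<Suc n}" True]
      by (intro dvd_sum) (metis finite_lessThan)
    ultimately show ?thesis by simp
  qed
  moreover have "card (positive_chains L (Suc n)) = card Upos + card Uneg"
  proof -
    let ?neg = "map (map_prod id Not) :: (nat \<times> bool) list \<Rightarrow> _"
    have neg_neg: "?neg (?neg xs) = xs" for xs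
      by (induction xs) auto
    have neg_mem: "(i, b) \<in> set (?neg xs) \<longleftrightarrow> (i, \<not> b) \<in> set xs" for i b xs
      using mem_antipode[of i b "set xs"] unfolding antipode_def by simp
    have neg_so: "?neg xs \<in> signed_orders m \<longleftrightarrow> xs \<in> signed_orders m" for xs m
    proof -
      have "map fst (?neg xs) = map fst xs" by (induction xs) auto
      then show ?thesis unfolding signed_orders_def by (metis (mono_tags, lifting) list.set_map mem_Collect_eq)
    qed
    have neg_alt: "alternates_on s (?f (?neg xs)) {..<Suc n} \<longleftrightarrow> alternates_on (\<not> s) (?f xs) {..<Suc n}"
      if xs: "xs \<in> signed_orders (Suc n)" for s xs
    proof -
      have pre: "sign_vector (Suc n) (set (take i xs))" for i
        using xs by (rule signed_orders_sign_vector)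
      have ne: "set (take (Suc i) xs) \<noteq> {}" for i
        using signed_orders_length[OF xs] by (cases xs) auto
      have "?f (?neg xs) i = flip (?f xs i)" for i
        using Suc.prems(1)[OF pre ne, of i]
        by (simp add: chain_label_def antipode_def take_map)
      then have "?f (?neg xs) = (\<lambda>i. flip (?f xs i))"
        by auto
      moreover have "?f xs j \<noteq> flip (?f xs i)" for i j
      proof (cases "i \<le> j")
        case True
        then have "set (take (Suc i) xs) \<subseteq> set (take (Suc j) xs)"
          by (intro set_take_subset_set_take) simp
        then show ?thesis
          using Suc.prems(2)[OF pre ne] unfolding chain_label_def by blast
      next
        case False
        then have "set (take (Suc j) xs) \<subseteq> set (take (Suc i) xs)"
          by (intro set_take_subset_set_take) simp
        then have "?f xs i \<noteq> flip (?f xs j)"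
          using Suc.prems(2)[OF pre ne] unfolding chain_label_def by blast
        then show ?thesis by (metis flip_flip)
      qed
      ultimately show ?thesis
        using alternates_on_flip[of "{..<Suc n}" "?f xs" s] by simp
    qed
    have U_neg: "?neg xs \<in> U \<longleftrightarrow> xs \<notin> U" if xs: "xs \<in> signed_orders (Suc n)" for xs
    proof -
      have "n \<in> fst ` set xs"
        using xs unfolding signed_orders_def by auto
      then obtain b where "(n, b) \<in> set xs"
        by auto
      moreover have "(n, c) \<in> set xs \<Longrightarrow> (n, \<not> c) \<notin> set xs" for c
        using signed_orders_sign_vector[OF xs, of "length xs"] unfolding sign_vector_iff by simp
      from this[of True] have "(n, True) \<in> set xs \<Longrightarrow> (n, False) \<notin> set xs"
        by simp
      ultimately have "(n, True) \<in> set xs \<longleftrightarrow> (n, False) \<notin> set xs"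
        by (cases b) auto
      then show ?thesis
        using xs neg_so by (simp add: U_def neg_mem del: set_map)
    qed
    have "positive_chains L (Suc n) = Upos \<union> ?neg ` Uneg"
    proof (intro equalityI subsetI)
      fix xs assume xs: "xs \<in> positive_chains L (Suc n)"
      show "xs \<in> Upos \<union> ?neg ` Uneg"
      proof (cases "xs \<in> U")
        case False
        then have "?neg xs \<in> Uneg"
          using xs U_neg[of xs] neg_alt[of xs False] unfolding positive_chains_def Uneg_def by simp
        then show ?thesis using neg_neg[of xs] by (metis UnI2 image_eqI)
      qed (use xs in \<open>auto simp: positive_chains_def Upos_def\<close>)
    next
      fix xs assume "xs \<in> Upos \<union> ?neg ` Uneg"
      then show "xs \<in> positive_chains L (Suc n)"
        using neg_alt neg_so unfolding positive_chains_def Upos_def Uneg_def U_def by auto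
    qed
    moreover have "Upos \<inter> ?neg ` Uneg = {}"
      using U_neg unfolding Upos_def Uneg_def U_def by blast
    moreover have "inj_on ?neg Uneg"
      by (rule inj_onI) (metis neg_neg)
    moreover have "finite Upos" "finite Uneg"
      using finU unfolding Upos_def Uneg_def by auto
    ultimately show ?thesis
      by (simp add: card_Un_disjoint card_image)
  qed
  ultimately show ?case
    using oddP by presburger
qed

text \<open>A chain provided by Fan's lemma has \<open>n\<close> distinct labels, no two of which are complementary.
  Hence the \<open>n\<close> levels are distinct.\<close>

lemma octahedral_Tucker:
  fixes level :: "(nat \<times> bool) set \<Rightarrow> nat" and sign :: "(nat \<times> bool) set \<Rightarrow> bool"
  assumes level_less: "\<And>X. sign_vector n X \<Longrightarrow> X \<noteq> {} \<Longrightarrow> level X < m"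
    and level_anti: "\<And>X. sign_vector n X \<Longrightarrow> X \<noteq> {} \<Longrightarrow> level (antipode X) = level X"
    and sign_anti: "\<And>X. sign_vector n X \<Longrightarrow> X \<noteq> {} \<Longrightarrow> sign (antipode X) \<longleftrightarrow> \<not> sign X"
    and no_compl: "\<And>X Y. sign_vector n Y \<Longrightarrow> X \<noteq> {} \<Longrightarrow> X \<subseteq> Y \<Longrightarrow> level X = level Y \<Longrightarrow>
      sign X \<longleftrightarrow> sign Y"
  shows "n \<le> m"
proof -
  define L where "L X = 2 * level X + of_bool (\<not> sign X)" for X
  have L_flip: "L Y = flip (L X) \<longleftrightarrow> level X = level Y \<and> sign X \<noteq> sign Y" for X Y
  proof -
    have "flip (L X) = 2 * level X + of_bool (sign X)"
      by (simp add: L_def flip_def)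
    then show ?thesis
      by (cases "sign X"; cases "sign Y")
        (auto simp: L_def double_not_eq_Suc_double Suc_double_not_eq_double)
  qed
  have "odd (card (positive_chains L n))"
  proof (rule Fan_parity)
    fix X assume "sign_vector n X" "X \<noteq> {}"
    then show "L (antipode X) = flip (L X)"
      unfolding L_flip by (simp add: level_anti sign_anti)
  next
    fix X Y assume "sign_vector n Y" "X \<noteq> {}" "X \<subseteq> Y"
    from no_compl[OF this] show "L Y \<noteq> flip (L X)"
      unfolding L_flip by blast
  qed
  then have "positive_chains L n \<noteq> {}"
    by auto
  then obtain xs where xs: "xs \<in> signed_orders n" and inj: "inj_on (chain_label L xs) {..<n}"
    unfolding positive_chains_def alternates_on_def by blast
  have pre: "sign_vector n (set (take i xs))" for i
    using xs by (rule signed_orders_sign_vector)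
  have ne: "set (take (Suc i) xs) \<noteq> {}" if "i < n" for i
    using signed_orders_length[OF xs] that by (cases xs) auto
  let ?l = "\<lambda>i. level (set (take (Suc i) xs))"
  have "inj_on ?l {..<n}"
  proof (rule linorder_inj_onI)
    fix i j assume ij: "i < j" "i \<in> {..<n}" "j \<in> {..<n}"
    have "set (take (Suc i) xs) \<subseteq> set (take (Suc j) xs)"
      using ij by (intro set_take_subset_set_take) simp
    then have "L (set (take (Suc i) xs)) = L (set (take (Suc j) xs))" if "?l i = ?l j"
      using no_compl[OF pre ne _ that] ij that by (simp add: L_def)
    then show "?l i \<noteq> ?l j"
      using inj ij unfolding inj_on_def chain_label_def by (metis less_irrefl)
  qed auto
  moreover have "?l ` {..<n} \<subseteq> {..<m}"
    using level_less pre ne by blast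
  ultimately show "n \<le> m"
    using card_inj_on_le[of ?l "{..<n}" "{..<m}"] by simp
qed

section \<open>Graphs of sign vectors that are nearly alternating\<close>

text \<open>The maximal length of an alternating subsequence of the coordinates below \<open>n\<close> that ends in the
  sign \<open>b\<close>.\<close>

primrec alternation :: "nat \<Rightarrow> bool \<Rightarrow> (nat \<times> bool) set \<Rightarrow> nat" where
  "alternation 0 b X = 0"
| "alternation (Suc n) b X =
    (if (n, b) \<in> X then max (alternation n b X) (Suc (alternation n (\<not> b) X)) else alternation n b X)"

lemma alternation_mono: "X \<subseteq> Y \<Longrightarrow> alternation n b X \<le> alternation n b Y"
proof (induction n arbitrary: b)
  case (Suc n)
  from Suc.IH[OF Suc.prems, of b] Suc.IH[OF Suc.prems, of "\<not> b"] Suc.prems show ?case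
    by (auto simp: max_def)
qed simp

lemma alternation_antipode: "alternation n b (antipode X) = alternation n (\<not> b) X"
  by (induction n arbitrary: b) auto

lemma alternation_restrict: "alternation n b (X \<inter> {..<m} \<times> UNIV) = alternation n b X" if "n \<le> m"
  using that by (induction n arbitrary: b) auto

lemma alternation_le_card: "alternation n b X \<le> card (fst ` X \<inter> {..<n})"
proof (induction n arbitrary: b)
  case (Suc n)
  show ?case
  proof (cases "(n, b) \<in> X")
    case True
    then have "n \<in> fst ` X" by force
    then have "fst ` X \<inter> {..<Suc n} = insert n (fst ` X \<inter> {..<n})"
      by auto
    then have "card (fst ` X \<inter> {..<Suc n}) = Suc (card (fst ` X \<inter> {..<n}))"
      by simp
    then show ?thesis
      using Suc.IH[of b] Suc.IH[of "\<not> b"] True by simp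
  next
    case False
    have "card (fst ` X \<inter> {..<n}) \<le> card (fst ` X \<inter> {..<Suc n})"
      by (intro card_mono) auto
    then show ?thesis
      using Suc.IH[of b] False by simp
  qed
qed simp

lemma alternation_le: "alternation n b X \<le> n"
  using alternation_le_card[of n b X] card_mono[of "{..<n}" "fst ` X \<inter> {..<n}"] by simp

text \<open>A longest alternating subsequence of a nonzero vector ends in a definite sign. That sign will be
  the sign of Tucker's label.\<close>

lemma alternation_differ:
  assumes "sign_vector m X"
  shows "alternation n b X \<le> Suc (alternation n (\<not> b) X) \<and>
    ((\<exists>i<n. \<exists>b. (i, b) \<in> X) \<longrightarrow> alternation n True X \<noteq> alternation n False X)"
proof (induction n arbitrary: b)
  case (Suc n)
  have cl: "alternation n True X \<le> Suc (alternation n False X)"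
    "alternation n False X \<le> Suc (alternation n True X)"
    using Suc.IH[of True] Suc.IH[of False] by auto
  have excl: "(n, False) \<notin> X" if "(n, True) \<in> X"
    using sign_vector_unique[OF assms that, of False] by blast
  consider "(n, True) \<in> X" | "(n, False) \<in> X" "(n, True) \<notin> X"
    | "(n, True) \<notin> X" "(n, False) \<notin> X"
    by blast
  then show ?case
  proof cases
    case 1
    then show ?thesis using excl cl by (cases b) auto
  next
    case 2
    then show ?thesis using excl cl by (cases b) auto
  next
    case 3
    then have "(\<exists>i<Suc n. \<exists>b. (i, b) \<in> X) \<longleftrightarrow> (\<exists>i<n. \<exists>b. (i, b) \<in> X)"
      by (metis (full_types) less_Suc_eq)
    then show ?thesis using 3 Suc.IH[of b] by (cases b) auto
  qed
qed simp

text \<open>With disjointness as adjacency, these vectors form a close relative of a Schrijver graph. Each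
  of them has at most \<open>d\<close> zeros, and for fixed \<open>d\<close> their number is polynomial in \<open>n\<close>.\<close>

definition near_alternating :: "nat \<Rightarrow> nat \<Rightarrow> (nat \<times> bool) set set" where
  "near_alternating n d = {X. sign_vector n X \<and> (\<exists>b. n \<le> alternation n b X + d)}"

lemma near_alternating_antipode: "X \<in> near_alternating n d \<Longrightarrow> antipode X \<in> near_alternating n d"
  unfolding near_alternating_def by (auto simp: alternation_antipode intro: exI[of _ "\<not> _"])

definition zeros :: "nat \<Rightarrow> (nat \<times> bool) set \<Rightarrow> nat set" where
  "zeros n X = {..<n} - fst ` X"

lemma card_zeros_near_alternating:
  assumes "X \<in> near_alternating n d"
  shows "card (zeros n X) \<le> d"
proof -
  obtain b where "n \<le> alternation n b X + d"
    using assms by (auto simp: near_alternating_def)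
  moreover have "card (zeros n X) = n - card (fst ` X \<inter> {..<n})"
    using card_Diff_subset_Int[of "{..<n}" "fst ` X"] unfolding zeros_def
    by (simp add: Int_commute)
  ultimately show ?thesis
    using alternation_le_card[of n b X] by linarith
qed

text \<open>The lower bound of Lovasz and Schrijver, in the combinatorial form due to Matousek. Vectors
  outside the graph are labelled by their alternation number, which takes \<open>n - d - 1\<close> values. A vector \<open>X\<close> of the graph is disjoint
  from its antipode; it is labelled by the smaller one of the colours of \<open>X\<close> and \<open>antipode X\<close>, with
  a sign that tells which of the two it is, so the largest colour is not used. Complementary labels
  on \<open>X \<subseteq> Y\<close> would give the same colour to the disjoint vectors \<open>X\<close> and \<open>antipode Y\<close>, or
  \<open>antipode X\<close> and \<open>Y\<close>. Thus Tucker's lemma yields \<open>n \<le> (n - d - 1) + (C - 1)\<close>.\<close>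

theorem near_alternating_chromatic:
  fixes c :: "(nat \<times> bool) set \<Rightarrow> nat"
  assumes "d < n"
    and colours: "\<And>X. X \<in> near_alternating n d \<Longrightarrow> c X < C"
    and proper: "\<And>X Y. X \<in> near_alternating n d \<Longrightarrow> Y \<in> near_alternating n d \<Longrightarrow> X \<inter> Y = {} \<Longrightarrow>
      c X \<noteq> c Y"
  shows "d + 2 \<le> C"
proof -
  let ?V = "near_alternating n d"
  let ?T = "alternation n True" and ?F = "alternation n False"
  define a where "a X = max (?T X) (?F X)" for X
  define level where
    "level X = (if a X + d < n then a X - 1 else n - d - 1 + min (c X) (c (antipode X)))" for X
  define sign where
    "sign X \<longleftrightarrow> (if a X + d < n then ?F X < ?T X else c X < c (antipode X))" for X
  have V_iff: "X \<in> ?V \<longleftrightarrow> \<not> a X + d < n" if "sign_vector n X" for X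
    using that unfolding near_alternating_def a_def
    by (auto simp: all_bool_eq ex_bool_eq max_def)
  have a_anti: "a (antipode X) = a X" for X
    by (simp add: a_def alternation_antipode max.commute)
  have differ: "?T X \<noteq> ?F X" if "sign_vector n X" "X \<noteq> {}" for X
  proof -
    obtain i b where "(i, b) \<in> X" using \<open>X \<noteq> {}\<close> by auto
    then have "\<exists>i<n. \<exists>b. (i, b) \<in> X"
      using sign_vector_less[OF that(1)] by blast
    then show ?thesis using alternation_differ[OF that(1)] by blast
  qed
  have a_pos: "0 < a X" if "sign_vector n X" "X \<noteq> {}" for X
    using differ[OF that] by (auto simp: a_def)
  have disj: "X \<inter> antipode Y = {}" "antipode X \<inter> Y = {}" if "X \<subseteq> Y" "sign_vector n Y" for X Y
    using that unfolding sign_vector_iff by (auto; blast)+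
  have c_neq: "c X \<noteq> c (antipode Y)" "c (antipode X) \<noteq> c Y"
    if "X \<subseteq> Y" "sign_vector n Y" "X \<in> ?V" "Y \<in> ?V" for X Y
    using disj[OF that(1,2)] that(3,4) proper near_alternating_antipode by blast+
  have "n \<le> (n - d - 1) + (C - 1)"
  proof (rule octahedral_Tucker[where level = level and sign = sign])
    fix X assume X: "sign_vector n X" "X \<noteq> {}"
    have "min (c X) (c (antipode X)) < C - 1" if "X \<in> ?V"
      using c_neq[OF order_refl X(1) that that] colours[OF that]
        colours[OF near_alternating_antipode[OF that]] by linarith
    then show "level X < (n - d - 1) + (C - 1)"
      using V_iff[OF X(1)] a_pos[OF X] by (auto simp: level_def)
    show "level (antipode X) = level X"
      by (simp add: level_def a_anti min.commute)
    have "c X \<noteq> c (antipode X)" if "X \<in> ?V"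
      using c_neq[OF order_refl X(1) that that] by simp
    then show "sign (antipode X) \<longleftrightarrow> \<not> sign X"
      using V_iff[OF X(1)] differ[OF X]
      by (auto simp: sign_def a_anti alternation_antipode)
  next
    fix X Y assume Y: "sign_vector n Y" and "X \<noteq> {}" and XY: "X \<subseteq> Y" and eq: "level X = level Y"
    have X: "sign_vector n X" using sign_vector_subset[OF Y XY] .
    have "Y \<noteq> {}" using XY \<open>X \<noteq> {}\<close> by blast
    note pos = a_pos[OF X \<open>X \<noteq> {}\<close>] a_pos[OF Y \<open>Y \<noteq> {}\<close>]
    consider (low) "a X + d < n" "a Y + d < n" | (high) "\<not> a X + d < n" "\<not> a Y + d < n"
      using eq pos by (fastforce simp: level_def split: if_splits)
    then show "sign X \<longleftrightarrow> sign Y"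
    proof cases
      case low
      then have "a X = a Y" using eq pos by (simp add: level_def)
      then show ?thesis
        using low differ[OF X \<open>X \<noteq> {}\<close>] differ[OF Y \<open>Y \<noteq> {}\<close>]
          alternation_mono[OF XY, of n True] alternation_mono[OF XY, of n False]
        by (auto simp: sign_def a_def max_def split: if_splits)
    next
      case high
      then have V: "X \<in> ?V" "Y \<in> ?V"
        using V_iff X Y by auto
      have "min (c X) (c (antipode X)) = min (c Y) (c (antipode Y))"
        using high eq by (simp add: level_def)
      then show ?thesis
        using high c_neq[OF XY Y V] by (auto simp: sign_def min_def split: if_splits)
    qed
  qed
  then show ?thesis
    using \<open>d < n\<close> by linarith
qed

text \<open>Either the last coordinate prolongs an alternating sequence, which determines it and leaves the
  defect \<open>e\<close>, or it has one of three values at the cost of one unit of the defect. This gives the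
  recursion \<open>f(n + 1, e) \<le> f(n, e) + 3 f(n, e - 1)\<close>.\<close>

lemma card_alternation_ge:
  "finite {X. sign_vector n X \<and> n \<le> alternation n b X + e} \<and>
    card {X. sign_vector n X \<and> n \<le> alternation n b X + e} \<le> (3 * n + 1) ^ e"
proof (induction n arbitrary: b e)
  case 0
  have "{X. sign_vector 0 X \<and> 0 \<le> alternation 0 b X + e} = {{}}"
    by (auto simp: sign_vector_def)
  then show ?case by simp
next
  case (Suc n)
  define S where "S n b e = {X. sign_vector n X \<and> n \<le> alternation n b X + e}" for n b e
  have IH: "finite (S n b e)" "card (S n b e) \<le> (3 * n + 1) ^ e" for b e
    unfolding S_def using Suc.IH by blast+
  have split: "(\<exists>Y \<in> S n (\<not> b) e. X = insert (n, b) Y) \<or>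
      (0 < e \<and> (\<exists>Y \<in> S n b (e - 1). X = Y \<or> X = insert (n, True) Y \<or> X = insert (n, False) Y))"
    if X: "X \<in> S (Suc n) b e" for X
  proof -
    let ?Y = "X \<inter> {..<n} \<times> UNIV"
    have Y: "sign_vector n ?Y"
      using X unfolding sign_vector_iff S_def by auto
    have a: "alternation n b' ?Y = alternation n b' X" for b'
      by (rule alternation_restrict) simp
    have sX: "sign_vector (Suc n) X"
      using X by (simp add: S_def)
    have shape: "X = ?Y \<or> X = insert (n, True) ?Y \<or> X = insert (n, False) ?Y"
    proof -
      have "(n, True) \<notin> X \<or> (n, False) \<notin> X"
        using sign_vector_unique[OF sX, of n True False] by blast
      moreover have "p \<in> ?Y \<or> p = (n, True) \<or> p = (n, False)" if p: "p \<in> X" for p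
        using p sign_vector_less[OF sX, of "fst p" "snd p"]
        by (cases p; cases "snd p") (auto simp: less_Suc_eq)
      then have "X = ?Y \<union> (X \<inter> {(n, True), (n, False)})"
        by blast
      ultimately show ?thesis by blast
    qed
    show ?thesis
    proof (cases "Suc n \<le> alternation n b X + e")
      case True
      then have "0 < e" using alternation_le[of n b X] by linarith
      moreover have "?Y \<in> S n b (e - 1)"
        using True Y \<open>0 < e\<close> by (simp add: a S_def)
      ultimately show ?thesis using shape by blast
    next
      case False
      then have "(n, b) \<in> X" "n \<le> alternation n (\<not> b) X + e"
        using X by (auto simp: S_def split: if_splits)
      moreover have "(n, \<not> b) \<notin> X"
        using sign_vector_unique[OF sX, of n b "\<not> b"] \<open>(n, b) \<in> X\<close> by blast
      ultimately have "X = insert (n, b) ?Y"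
        using shape by (cases b) auto
      moreover have "?Y \<in> S n (\<not> b) e"
        using Y \<open>n \<le> alternation n (\<not> b) X + e\<close> by (simp add: a S_def)
      ultimately show ?thesis by blast
    qed
  qed
  have "finite (S (Suc n) b e) \<and> card (S (Suc n) b e) \<le> (3 * Suc n + 1) ^ e"
  proof (cases e)
    case 0
    have "S (Suc n) b e \<subseteq> insert (n, b) ` S n (\<not> b) e"
      using split 0 by blast
    then have "finite (S (Suc n) b e)" "card (S (Suc n) b e) \<le> card (S n (\<not> b) e)"
      using IH(1) by (auto intro: finite_subset surj_card_le)
    then show ?thesis
      using IH(2)[of "\<not> b" e] 0 by simp
  next
    case (Suc e')
    let ?A = "S n (\<not> b) e" and ?B = "S n b e'"
    let ?U = "insert (n, b) ` ?A \<union> (?B \<union> (insert (n, True) ` ?B \<union> insert (n, False) ` ?B))"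
    have sub: "S (Suc n) b e \<subseteq> ?U"
    proof
      fix X assume "X \<in> S (Suc n) b e"
      from split[OF this] show "X \<in> ?U"
        unfolding Suc by auto
    qed
    have "card ?U \<le> card (insert (n, b) ` ?A)
        + (card ?B + (card (insert (n, True) ` ?B) + card (insert (n, False) ` ?B)))"
      by (meson add_left_mono card_Un_le order_trans)
    also have "\<dots> \<le> card ?A + (card ?B + (card ?B + card ?B))"
      by (intro add_mono card_image_le IH order_refl)
    also have "\<dots> \<le> (3 * n + 1) ^ e + 3 * (3 * n + 1) ^ e'"
      using IH(2)[of "\<not> b" e] IH(2)[of b e'] by linarith
    also have "\<dots> = (3 * n + 4) * (3 * n + 1) ^ e'"
      using Suc by (simp add: algebra_simps)
    also have "\<dots> \<le> (3 * n + 4) * (3 * n + 4) ^ e'"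
      by (intro mult_left_mono power_mono) auto
    also have "\<dots> = (3 * Suc n + 1) ^ e"
      using Suc by (simp add: add.commute)
    finally have U: "card ?U \<le> (3 * Suc n + 1) ^ e" .
    have "finite ?U"
      using IH(1) by simp
    then have "finite (S (Suc n) b e)" "card (S (Suc n) b e) \<le> card ?U"
      using sub by (auto intro: finite_subset card_mono)
    then show ?thesis
      using U by linarith
  qed
  then show ?case
    unfolding S_def .
qed

lemma card_near_alternating:
  "finite (near_alternating n d)" "card (near_alternating n d) \<le> 2 * (3 * n + 1) ^ d"
proof -
  let ?S = "\<lambda>b. {X. sign_vector n X \<and> n \<le> alternation n b X + d}"
  have eq: "near_alternating n d = ?S True \<union> ?S False"
    unfolding near_alternating_def by (auto simp: ex_bool_eq)
  show "finite (near_alternating n d)"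
    unfolding eq using card_alternation_ge by blast
  show "card (near_alternating n d) \<le> 2 * (3 * n + 1) ^ d"
    unfolding eq using card_Un_le[of "?S True" "?S False"] card_alternation_ge[of n True d]
      card_alternation_ge[of n False d] by linarith
qed

text \<open>Three vectors with few zeros have a common nonzero coordinate, and two of the three agree there.\<close>

lemma near_alternating_triangle_free:
  assumes "3 * d < n" "X \<in> near_alternating n d" "Y \<in> near_alternating n d"
    "W \<in> near_alternating n d"
  shows "X \<inter> Y \<noteq> {} \<or> Y \<inter> W \<noteq> {} \<or> X \<inter> W \<noteq> {}"
proof -
  have "card (zeros n X \<union> zeros n Y \<union> zeros n W) \<le> 3 * d"
    using card_Un_le[of "zeros n X \<union> zeros n Y" "zeros n W"] card_Un_le[of "zeros n X" "zeros n Y"]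
      assms(2-4)[THEN card_zeros_near_alternating] by linarith
  then have "\<not> {..<n} \<subseteq> zeros n X \<union> zeros n Y \<union> zeros n W"
    using assms(1) card_mono[of "zeros n X \<union> zeros n Y \<union> zeros n W" "{..<n}"]
    by (auto simp: zeros_def)
  then obtain i where "i \<in> fst ` X" "i \<in> fst ` Y" "i \<in> fst ` W"
    unfolding zeros_def by blast
  then obtain p q r where "(i, p) \<in> X" "(i, q) \<in> Y" "(i, r) \<in> W"
    by auto
  then show ?thesis
    by (cases p; cases q; cases r) auto
qed

section \<open>Bit matrices with constant rows and columns on small sets\<close>

text \<open>A random matrix has this property by the union bound. For a fixed set \<open>J\<close> of \<open>s\<close> columns, the
  probability that no row is constantly true on \<open>J\<close> is \<open>(1 - 2\<^sup>-\<^sup>s)\<^sup>n\<close>, which is at most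
  \<open>2\<close> to the power \<open>- n / 2\<^sup>s = - 2\<^sup>s\<^sup>+\<^sup>3\<close>, and there are at most \<open>n\<^sup>s\<close> such sets, that is,
  \<open>2\<close> to the power \<open>(2 * s + 3) * s\<close>. The argument is carried out by counting matrices, encoded as
  relations on \<open>{..<n}\<close>: \<open>R J\<close> contains those that fail on the columns \<open>J\<close>, and \<open>C I\<close> those that
  fail on the rows \<open>I\<close>.\<close>

lemma exists_universal_bit_matrix:
  fixes s :: nat
  defines "n \<equiv> 2 ^ (2 * s + 3)"
  obtains w :: "nat \<Rightarrow> nat \<Rightarrow> bool"
  where "\<And>J. J \<subseteq> {..<n} \<Longrightarrow> card J \<le> s \<Longrightarrow> \<exists>i<n. \<forall>j\<in>J. w i j"
    and "\<And>I. I \<subseteq> {..<n} \<Longrightarrow> card I \<le> s \<Longrightarrow> \<exists>j<n. \<forall>i\<in>I. \<not> w i j"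
proof -
  let ?V = "{..<n}"
  define \<Omega> where "\<Omega> = Pow (?V \<times> ?V)"
  define R where "R J = {W \<in> \<Omega>. \<forall>i<n. \<not> {i} \<times> J \<subseteq> W}" for J
  define C where "C I = {W \<in> \<Omega>. \<forall>j<n. I \<times> {j} \<inter> W \<noteq> {}}" for I
  define \<J> where "\<J> = {J. J \<subseteq> ?V \<and> card J = s}"
  have n: "n > 0" "s \<le> n"
    unfolding n_def by (simp, metis le_add1 less_exp less_imp_le mult_2 order_trans trans_le_add1)
  have fin: "finite \<Omega>" "finite \<J>"
    unfolding \<Omega>_def \<J>_def by auto
  have card_row: "card {S \<in> Pow ?V. \<not> J \<subseteq> S} = 2 ^ n - 2 ^ (n - s)" if "J \<in> \<J>" for J
  proof -
    have J: "J \<subseteq> ?V" "card J = s" "finite J"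
      using that unfolding \<J>_def by (auto intro: finite_subset)
    have "{S \<in> Pow ?V. J \<subseteq> S} = (\<lambda>S. J \<union> S) ` Pow (?V - J)"
    proof
      show "{S \<in> Pow ?V. J \<subseteq> S} \<subseteq> (\<lambda>S. J \<union> S) ` Pow (?V - J)"
      proof
        fix S assume "S \<in> {S \<in> Pow ?V. J \<subseteq> S}"
        then have "S = J \<union> (S - J)" "S - J \<in> Pow (?V - J)" by auto
        then show "S \<in> (\<lambda>S. J \<union> S) ` Pow (?V - J)" by (rule image_eqI)
      qed
    qed (use J in auto)
    moreover have "inj_on (\<lambda>S. J \<union> S) (Pow (?V - J))"
      by (rule inj_onI) blast
    ultimately have sup: "card {S \<in> Pow ?V. J \<subseteq> S} = 2 ^ (n - s)"
      using J by (simp add: card_image card_Pow card_Diff_subset)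
    have "{S \<in> Pow ?V. \<not> J \<subseteq> S} = Pow ?V - {S \<in> Pow ?V. J \<subseteq> S}"
      by auto
    moreover have "finite {S \<in> Pow ?V. J \<subseteq> S}"
      by (rule finite_subset[of _ "Pow ?V"]) auto
    ultimately have "card {S \<in> Pow ?V. \<not> J \<subseteq> S} = card (Pow ?V) - card {S \<in> Pow ?V. J \<subseteq> S}"
      by (metis (no_types, lifting) card_Diff_subset mem_Collect_eq subsetI)
    then show ?thesis
      unfolding sup by (simp add: card_Pow)
  qed
  have card_R: "card (R J) \<le> (2 ^ n - 2 ^ (n - s)) ^ n" if "J \<in> \<J>" for J
  proof -
    let ?rows = "\<lambda>W. \<lambda>i\<in>?V. W `` {i}"
    have "inj_on ?rows (R J)"
    proof (rule inj_onI)
      fix W W' assume W: "W \<in> R J" "W' \<in> R J" and eq: "?rows W = ?rows W'"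
      have "W `` {i} = W' `` {i}" if "i \<in> ?V" for i
        using fun_cong[OF eq, of i] that by simp
      then have "(i, j) \<in> W \<longleftrightarrow> (i, j) \<in> W'" if "i \<in> ?V" for i j
        using that by blast
      then show "W = W'"
        using W unfolding R_def \<Omega>_def by blast
    qed
    moreover have "?rows ` R J \<subseteq> (\<Pi>\<^sub>E i\<in>?V. {S \<in> Pow ?V. \<not> J \<subseteq> S})"
    proof (intro image_subsetI PiE_I)
      fix W i assume "W \<in> R J" "i \<in> ?V"
      then show "(\<lambda>i\<in>?V. W `` {i}) i \<in> {S \<in> Pow ?V. \<not> J \<subseteq> S}"
        unfolding R_def \<Omega>_def by auto
    qed auto
    moreover have "finite (\<Pi>\<^sub>E i\<in>?V. {S \<in> Pow ?V. \<not> J \<subseteq> S})"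
      by (intro finite_PiE) auto
    ultimately have "card (R J) \<le> card (\<Pi>\<^sub>E i\<in>?V. {S \<in> Pow ?V. \<not> J \<subseteq> S})"
      by (rule card_inj_on_le)
    then show ?thesis
      using card_row[OF that] by (simp add: card_PiE)
  qed
  have card_C: "card (C J) \<le> (2 ^ n - 2 ^ (n - s)) ^ n" if "J \<in> \<J>" for J
  proof -
    \<comment> \<open>Transposing and complementing exchanges the two kinds of failure.\<close>
    let ?f = "\<lambda>W. ?V \<times> ?V - W\<inverse>"
    have J: "J \<subseteq> ?V" using that unfolding \<J>_def by auto
    have "inj_on ?f (C J)"
      unfolding C_def \<Omega>_def by (rule inj_onI) auto
    moreover have "?f ` C J \<subseteq> R J"
      using J unfolding C_def R_def \<Omega>_def by (auto; blast)
    moreover have "finite (R J)"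
      using fin unfolding R_def by auto
    ultimately have "card (C J) \<le> card (R J)"
      by (rule card_inj_on_le)
    then show ?thesis
      using card_R[OF that] by simp
  qed
  have card_J: "card \<J> \<le> n ^ s"
    unfolding \<J>_def using n_subsets[of ?V s] binomial_le_pow[of s n] n by simp
  have few: "2 * (card \<J> * (2 ^ n - 2 ^ (n - s)) ^ n) < 2 ^ (n * n)"
  proof -
    have "(2 :: real) ^ (n - s) = 2 ^ n / 2 ^ s"
      using n by (simp add: power_diff)
    then have "real (2 ^ n - 2 ^ (n - s)) = 2 ^ n * (1 - 1 / 2 ^ s)"
      by (subst of_nat_diff) (auto simp: right_diff_distrib)
    then have "real (2 * (card \<J> * (2 ^ n - 2 ^ (n - s)) ^ n))
        = 2 * real (card \<J>) * (2 ^ n * (1 - 1 / 2 ^ s)) ^ n"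
      by (simp only: of_nat_mult of_nat_power of_nat_numeral mult.assoc)
    also have "\<dots> \<le> 2 * 2 ^ ((2 * s + 3) * s) * (2 ^ n * (1 - 1 / 2 ^ s)) ^ n"
    proof -
      have "real (card \<J>) \<le> 2 ^ ((2 * s + 3) * s)"
        using card_J unfolding n_def
        by (metis of_nat_le_iff of_nat_numeral of_nat_power power_mult)
      then show ?thesis
        by (intro mult_right_mono mult_left_mono) auto
    qed
    also have "\<dots> = 2 ^ (n * n) * (2 ^ (1 + (2 * s + 3) * s) * (1 - 1 / 2 ^ s) ^ n)"
      by (simp add: power_mult_distrib power_mult)
    also have "\<dots> < 2 ^ (n * n) * 1"
    proof (intro mult_strict_left_mono)
      have half: "(1 - 1 / 2 ^ s) ^ 2 ^ s \<le> (1 / 2 :: real)"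
      proof -
        have "(1 - 1 / 2 ^ s) ^ 2 ^ s \<le> exp (- (1 / 2 ^ s) :: real) ^ 2 ^ s"
          using exp_ge_add_one_self[of "- (1 / 2 ^ s)"] by (intro power_mono) auto
        also have "\<dots> = exp (- 1 :: real)"
          by (simp flip: exp_of_nat_mult)
        also have "\<dots> \<le> 1 / 2"
          using exp_ge_add_one_self[of 1] by (simp add: exp_minus field_simps)
        finally show ?thesis .
      qed
      have "2 * s + 3 = s + (s + 3)"
        by simp
      then have "n = 2 ^ s * 2 ^ (s + 3)"
        unfolding n_def by (simp only: power_add)
      then have "(1 - 1 / 2 ^ s) ^ n = (((1 - 1 / 2 ^ s) ^ 2 ^ s) ^ 2 ^ (s + 3) :: real)"
        by (simp only: power_mult)
      also have "\<dots> \<le> (1 / 2 :: real) ^ 2 ^ (s + 3)"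
        using half by (intro power_mono) auto
      finally have small: "(1 - 1 / 2 ^ s) ^ n \<le> (1 / 2 :: real) ^ 2 ^ (s + 3)" .
      have exps: "1 + (2 * s + 3) * s < 2 ^ (s + 3)"
      proof (induction s)
        case (Suc s)
        have "4 * s + 5 \<le> 8 * 2 ^ s"
          by (induction s) auto
        then show ?case using Suc.IH by (simp add: algebra_simps power_add)
      qed simp
      have "2 ^ (1 + (2 * s + 3) * s) * (1 - 1 / 2 ^ s) ^ n
          \<le> 2 ^ (1 + (2 * s + 3) * s) * (1 / 2 :: real) ^ 2 ^ (s + 3)"
        using small by (intro mult_left_mono) auto
      also have "\<dots> < 2 ^ 2 ^ (s + 3) * (1 / 2 :: real) ^ 2 ^ (s + 3)"
        using exps by (intro mult_strict_right_mono power_strict_increasing) auto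
      also have "\<dots> = 1"
        by (simp flip: power_mult_distrib)
      finally show "2 ^ (1 + (2 * s + 3) * s) * (1 - 1 / 2 ^ s) ^ n < (1 :: real)" .
    qed simp
    finally have "real (2 * (card \<J> * (2 ^ n - 2 ^ (n - s)) ^ n)) < real (2 ^ (n * n))"
      by simp
    then show ?thesis
      by (simp only: of_nat_less_iff)
  qed
  have bad: "card ((\<Union>J\<in>\<J>. R J) \<union> (\<Union>J\<in>\<J>. C J))
      \<le> 2 * (card \<J> * (2 ^ n - 2 ^ (n - s)) ^ n)"
  proof -
    have "card (\<Union>J\<in>\<J>. R J) \<le> card \<J> * (2 ^ n - 2 ^ (n - s)) ^ n"
      using card_UN_le[OF fin(2), of R] sum_bounded_above[of \<J> "\<lambda>J. card (R J)"] card_R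
      by (metis (no_types, lifting) of_nat_id order_trans)
    moreover have "card (\<Union>J\<in>\<J>. C J) \<le> card \<J> * (2 ^ n - 2 ^ (n - s)) ^ n"
      using card_UN_le[OF fin(2), of C] sum_bounded_above[of \<J> "\<lambda>J. card (C J)"] card_C
      by (metis (no_types, lifting) of_nat_id order_trans)
    ultimately show ?thesis
      using card_Un_le[of "\<Union>J\<in>\<J>. R J" "\<Union>J\<in>\<J>. C J"] by linarith
  qed
  have "card \<Omega> = 2 ^ (n * n)"
    unfolding \<Omega>_def by (simp add: card_Pow card_cartesian_product)
  have "\<not> \<Omega> \<subseteq> (\<Union>J\<in>\<J>. R J) \<union> (\<Union>J\<in>\<J>. C J)"
  proof -
    have "finite ((\<Union>J\<in>\<J>. R J) \<union> (\<Union>J\<in>\<J>. C J))"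
      using fin unfolding R_def C_def by auto
    then have "card \<Omega> \<le> card ((\<Union>J\<in>\<J>. R J) \<union> (\<Union>J\<in>\<J>. C J))"
      if "\<Omega> \<subseteq> (\<Union>J\<in>\<J>. R J) \<union> (\<Union>J\<in>\<J>. C J)"
      using that by (rule card_mono)
    then show ?thesis
      using bad few \<open>card \<Omega> = 2 ^ (n * n)\<close> by linarith
  qed
  then obtain W where W: "W \<in> \<Omega>" "\<And>J. J \<in> \<J> \<Longrightarrow> W \<notin> R J" "\<And>J. J \<in> \<J> \<Longrightarrow> W \<notin> C J"
    by blast
  have extend: "\<exists>J'\<in>\<J>. J \<subseteq> J'" if "J \<subseteq> ?V" "card J \<le> s" for J
    using exists_subset_between[of J s ?V] that n unfolding \<J>_def by auto
  show ?thesis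
  proof (rule that[of "\<lambda>i j. (i, j) \<in> W"])
    show "\<exists>i<n. \<forall>j\<in>J. (i, j) \<in> W" if J: "J \<subseteq> ?V" "card J \<le> s" for J
    proof -
      obtain J' where "J' \<in> \<J>" "J \<subseteq> J'" using extend[OF J] by blast
      then show ?thesis using W(1) W(2)[of J'] unfolding R_def by auto
    qed
    show "\<exists>j<n. \<forall>i\<in>I. (i, j) \<notin> W" if I: "I \<subseteq> ?V" "card I \<le> s" for I
    proof -
      obtain I' where "I' \<in> \<J>" "I \<subseteq> I'" using extend[OF I] by blast
      then show ?thesis using W(1) W(3)[of I'] unfolding C_def by auto
    qed
  qed
qed

section \<open>Tournaments with a prescribed graph of back edges\<close>

lemma chromatic_number_le_card_image:
  assumes "finite S" and "\<And>c. c \<in> f ` S \<Longrightarrow> trans (arcs_ends G \<inter> {v \<in> S. f v = c} \<times> {v \<in> S. f v = c})"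
  shows "chromatic_number (G \<restriction> S) \<le> card (f ` S)"
proof -
  define P where "P = (\<lambda>c. {v \<in> S. f v = c}) ` f ` S"
  have "partition_on (verts (G \<restriction> S)) P"
    unfolding P_def by (rule partition_onI) (auto simp: disjnt_def)
  moreover have "\<forall>B\<in>P. transitive_digraph ((G \<restriction> S) \<restriction> B)"
  proof
    fix B assume "B \<in> P"
    then obtain c where c: "c \<in> f ` S" and B: "B = {v \<in> S. f v = c}"
      unfolding P_def by blast
    have "arcs_ends ((G \<restriction> S) \<restriction> B) = arcs_ends G \<inter> B \<times> B"
      unfolding arcs_ends_induce_subgraph B by auto
    then show "transitive_digraph ((G \<restriction> S) \<restriction> B)"
      using assms(2)[OF c] unfolding transitive_digraph_def B by simp
  qed
  ultimately have "chromatic_number (G \<restriction> S) \<le> card P"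
    unfolding chromatic_number_def by (intro Least_le) blast
  also have "\<dots> \<le> card (f ` S)"
    unfolding P_def using assms(1) by (intro card_image_le) simp
  finally show ?thesis .
qed

text \<open>The tournament on \<open>{..<N}\<close> in which \<open>E\<close>, read on the pairs \<open>u < v\<close>, is the graph of back
  edges with respect to the natural order.\<close>

definition back_edge_tournament :: "nat \<Rightarrow> (nat \<Rightarrow> nat \<Rightarrow> bool) \<Rightarrow> (nat, nat \<times> nat) pre_digraph" where
  "back_edge_tournament N E = \<lparr>verts = {..<N},
    arcs = {(u, v). u < N \<and> v < N \<and> (u < v \<and> \<not> E u v \<or> v < u \<and> E v u)}, tail = fst, head = snd\<rparr>"

lemma verts_back_edge_tournament [simp]: "verts (back_edge_tournament N E) = {..<N}"
  by (simp add: back_edge_tournament_def)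

lemma arcs_ends_back_edge_tournament:
  "(u, v) \<in> arcs_ends (back_edge_tournament N E) \<longleftrightarrow>
    u < N \<and> v < N \<and> (u < v \<and> \<not> E u v \<or> v < u \<and> E v u)"
  by (auto simp: arcs_ends_conv back_edge_tournament_def)

lemma tournament_back_edge_tournament: "tournament (back_edge_tournament N E)"
proof -
  let ?T = "back_edge_tournament N E"
  have "finite (arcs ?T)"
    by (rule finite_subset[of _ "{..<N} \<times> {..<N}"]) (auto simp: back_edge_tournament_def)
  then interpret digraph ?T
    by unfold_locales (auto simp: back_edge_tournament_def arc_to_ends_def)
  show ?thesis
    by unfold_locales (auto simp: arcs_ends_back_edge_tournament)
qed

text \<open>A set without back edges is ordered by \<open><\<close>, so a proper colouring of the back edges by \<open>f\<close> is a
  partition into transitive parts.\<close>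

lemma chromatic_number_back_edge_le:
  assumes "S \<subseteq> {..<N}" "\<And>u v. u \<in> S \<Longrightarrow> v \<in> S \<Longrightarrow> u < v \<Longrightarrow> E u v \<Longrightarrow> f u \<noteq> f v"
  shows "chromatic_number (back_edge_tournament N E \<restriction> S) \<le> card (f ` S)"
proof (rule chromatic_number_le_card_image)
  show "finite S" using assms(1) finite_subset by blast
  fix c
  let ?B = "{v \<in> S. f v = c}"
  have "arcs_ends (back_edge_tournament N E) \<inter> ?B \<times> ?B = {(u, v). u \<in> ?B \<and> v \<in> ?B \<and> u < v}"
  proof (intro equalityI subsetI)
    fix p assume "p \<in> {(u, v). u \<in> ?B \<and> v \<in> ?B \<and> u < v}"
    then obtain u v where p: "p = (u, v)" "u \<in> ?B" "v \<in> ?B" "u < v" by blast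
    then have "\<not> E u v" "u < N" "v < N"
      using assms(1) assms(2)[of u v] by auto
    then show "p \<in> arcs_ends (back_edge_tournament N E) \<inter> ?B \<times> ?B"
      using p by (simp add: arcs_ends_back_edge_tournament)
  next
    fix p assume p: "p \<in> arcs_ends (back_edge_tournament N E) \<inter> ?B \<times> ?B"
    then obtain u v where uv: "p = (u, v)" "u \<in> ?B" "v \<in> ?B"
      "(u, v) \<in> arcs_ends (back_edge_tournament N E)"
      by blast
    then have "\<not> (v < u \<and> E v u)"
      using assms(2)[of v u] by auto
    then show "p \<in> {(u, v). u \<in> ?B \<and> v \<in> ?B \<and> u < v}"
      using uv by (auto simp: arcs_ends_back_edge_tournament)
  qed
  then show "trans (arcs_ends (back_edge_tournament N E) \<inter> ?B \<times> ?B)"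
    by (auto intro: transI)
qed

text \<open>A transitive set induces a bipartite graph of back edges if the graph is triangle-free: whether a
  vertex is the upper end of a back edge inside the set is a proper colouring. Indeed, if \<open>u < v\<close> is
  a back edge and \<open>u\<close> is itself the upper end of a back edge from \<open>t\<close>, then \<open>v \<rightarrow> u \<rightarrow> t\<close>, and
  transitivity makes \<open>t\<close>, \<open>u\<close>, \<open>v\<close> a triangle. So two colours suffice for
  each part of an optimal partition.\<close>

lemma triangle_free_back_edge_colouring:
  assumes S: "S \<subseteq> {..<N}"
    and tf: "\<And>u v w. u \<in> S \<Longrightarrow> v \<in> S \<Longrightarrow> w \<in> S \<Longrightarrow> u < v \<Longrightarrow> v < w \<Longrightarrow> \<not> (E u v \<and> E v w \<and> E u w)"
  obtains c :: "nat \<Rightarrow> nat"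
  where "\<And>u. u \<in> S \<Longrightarrow> c u < 2 * chromatic_number (back_edge_tournament N E \<restriction> S)"
    and "\<And>u v. u \<in> S \<Longrightarrow> v \<in> S \<Longrightarrow> u < v \<Longrightarrow> E u v \<Longrightarrow> c u \<noteq> c v"
proof -
  let ?T = "back_edge_tournament N E"
  interpret T: tournament ?T by (rule tournament_back_edge_tournament)
  interpret TS: tournament "?T \<restriction> S"
    by (rule T.tournament_induce_subgraph) (use S in simp)
  obtain P where P: "partition_on S P" "card P = chromatic_number (?T \<restriction> S)"
    and trans: "\<And>B. B \<in> P \<Longrightarrow> transitive_digraph ((?T \<restriction> S) \<restriction> B)"
    by (rule TS.chromatic_number_witness) auto
  have "finite S" using S finite_subset by blast
  then have "finite P" using P(1) finite_elements by blast
  then obtain g where g: "bij_betw g P {0..<card P}"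
    using ex_bij_betw_finite_nat by blast
  have "\<forall>u\<in>S. \<exists>B. B \<in> P \<and> u \<in> B"
    using P(1) unfolding partition_on_def by blast
  then obtain blk where blk: "\<And>u. u \<in> S \<Longrightarrow> blk u \<in> P \<and> u \<in> blk u"
    by metis
  define top where "top u \<longleftrightarrow> (\<exists>t \<in> blk u. t < u \<and> E t u)" for u
  define c where "c u = 2 * g (blk u) + of_bool (top u)" for u
  show ?thesis
  proof (rule that)
    fix u assume u: "u \<in> S"
    have "g (blk u) < card P"
      using g blk[OF u] by (auto simp: bij_betw_def)
    then show "c u < 2 * chromatic_number (?T \<restriction> S)"
      by (simp add: c_def P(2)[symmetric])
  next
    fix u v assume uv: "u \<in> S" "v \<in> S" "u < v" "E u v"
    show "c u \<noteq> c v"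
    proof
      assume "c u = c v"
      then have eq: "g (blk u) = g (blk v)" "top u = top v"
        unfolding c_def by (cases "top u"; cases "top v";
          simp add: double_not_eq_Suc_double Suc_double_not_eq_double)+
      then have same: "blk u = blk v"
        using g blk uv(1,2) by (metis bij_betw_def inj_onD)
      let ?B = "blk u"
      have B: "?B \<in> P" "u \<in> ?B" "v \<in> ?B"
        using blk[OF uv(1)] blk[OF uv(2)] same by auto
      then have "top v"
        using uv same unfolding top_def by metis
      then obtain t where t: "t \<in> ?B" "t < u" "E t u"
        using eq unfolding top_def by auto
      have BS: "?B \<subseteq> S"
        using B(1) P(1) by (auto simp: partition_on_def)
      have arcs: "arcs_ends ((?T \<restriction> S) \<restriction> ?B) = arcs_ends ?T \<inter> ?B \<times> ?B"
        unfolding arcs_ends_induce_subgraph using BS by auto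
      have "(v, u) \<in> arcs_ends ?T" "(u, t) \<in> arcs_ends ?T"
        using uv t B BS S by (auto simp: arcs_ends_back_edge_tournament)
      then have "(v, t) \<in> arcs_ends ?T \<inter> ?B \<times> ?B"
        using trans[OF B(1)] B t(1) unfolding transitive_digraph_def arcs
        by (auto elim: transE)
      then have "E t v"
        using t(2) uv(3) by (auto simp: arcs_ends_back_edge_tournament)
      then show False
        using tf[of t u v] t uv BS by blast
    qed
  qed
qed

section \<open>Two copies of the graph\<close>

text \<open>The shift \<open>r\<close> allows two disjoint copies of the graph to be placed in one tournament.\<close>

lemma near_alternating_back_edge_chromatic_ge:
  fixes x :: "nat \<Rightarrow> (nat \<times> bool) set"
  assumes "3 * d < n" and x: "bij_betw x {..<M} (near_alternating n d)" and "r + M \<le> N"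
    and E: "\<And>u v. r \<le> u \<Longrightarrow> u < v \<Longrightarrow> v < r + M \<Longrightarrow> E u v \<longleftrightarrow> x (u - r) \<inter> x (v - r) = {}"
  shows "d + 2 \<le> 2 * chromatic_number (back_edge_tournament N E \<restriction> {r..<r + M})"
proof -
  let ?S = "{r..<r + M}" and ?V = "near_alternating n d"
  have xV: "x (u - r) \<in> ?V" if "u \<in> ?S" for u
    using x that by (auto simp: bij_betw_def)
  have tf: "\<not> (E u v \<and> E v w \<and> E u w)"
    if "u \<in> ?S" "v \<in> ?S" "w \<in> ?S" "u < v" "v < w" for u v w
    using near_alternating_triangle_free[OF assms(1) xV xV xV, of u v w] that
      E[of u v] E[of v w] E[of u w] by auto
  have sub: "?S \<subseteq> {..<N}"
    using assms(3) by auto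
  obtain c :: "nat \<Rightarrow> nat" where c: "\<And>u. u \<in> ?S \<Longrightarrow> c u < 2 * chromatic_number (back_edge_tournament N E \<restriction> ?S)"
      and proper: "\<And>u v. u \<in> ?S \<Longrightarrow> v \<in> ?S \<Longrightarrow> u < v \<Longrightarrow> E u v \<Longrightarrow> c u \<noteq> c v"
    by (rule triangle_free_back_edge_colouring[OF sub, of E]) (use tf in blast)+
  define y where "y X = r + inv_into {..<M} x X" for X
  have y: "y X \<in> ?S" "x (y X - r) = X" if "X \<in> ?V" for X
    using bij_betw_inv_into[OF x] bij_betw_inv_into_right[OF x] that
    by (auto simp: y_def bij_betw_def)
  show ?thesis
  proof (rule near_alternating_chromatic[where c = "c \<circ> y" and n = n])
    show "d < n" using assms(1) by simp
    fix X assume X: "X \<in> ?V"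
    then show "(c \<circ> y) X < 2 * chromatic_number (back_edge_tournament N E \<restriction> ?S)"
      using c y by simp
    fix Y assume Y: "Y \<in> ?V" and disj: "X \<inter> Y = {}"
    have "X \<noteq> {}"
      using card_zeros_near_alternating[OF X] assms(1) by (auto simp: zeros_def)
    then have "X \<noteq> Y"
      using disj by blast
    then have "y X \<noteq> y Y"
      using y(2)[OF X] y(2)[OF Y] by metis
    then consider "y X < y Y" | "y Y < y X" by linarith
    then show "(c \<circ> y) X \<noteq> (c \<circ> y) Y"
    proof cases
      case 1
      then have "E (y X) (y Y)"
        using E[of "y X" "y Y"] y[OF X] y[OF Y] disj by simp
      then show ?thesis
        using proper[OF y(1)[OF X] y(1)[OF Y] 1] by simp
    next
      case 2
      then have "E (y Y) (y X)"
        using E[of "y Y" "y X"] y[OF X] y[OF Y] disj by (simp add: Int_commute)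
      then show ?thesis
        using proper[OF y(1)[OF Y] y(1)[OF X] 2] by simp
    qed
  qed
qed

text \<open>Two vectors with the same nonzero sign at \<open>i\<close> are not disjoint, so the sign at \<open>i\<close> is a proper
  colouring of the back edges.\<close>

lemma common_support_chromatic_le_2:
  fixes x :: "nat \<Rightarrow> (nat \<times> bool) set"
  assumes "S \<subseteq> {r..<r + M}" "r + M \<le> N"
    and E: "\<And>u v. r \<le> u \<Longrightarrow> u < v \<Longrightarrow> v < r + M \<Longrightarrow> E u v \<longleftrightarrow> x (u - r) \<inter> x (v - r) = {}"
    and i: "\<And>u. u \<in> S \<Longrightarrow> i \<in> fst ` x (u - r)"
  shows "chromatic_number (back_edge_tournament N E \<restriction> S) \<le> 2"
proof -
  let ?f = "\<lambda>u. (i, True) \<in> x (u - r)"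
  have "chromatic_number (back_edge_tournament N E \<restriction> S) \<le> card (?f ` S)"
  proof (rule chromatic_number_back_edge_le)
    show "S \<subseteq> {..<N}" using assms(1,2) by auto
    fix u v assume uv: "u \<in> S" "v \<in> S" "u < v" "E u v"
    then have disj: "x (u - r) \<inter> x (v - r) = {}"
      using E[of u v] subsetD[OF assms(1) uv(1)] subsetD[OF assms(1) uv(2)] by simp
    obtain b b' where "(i, b) \<in> x (u - r)" "(i, b') \<in> x (v - r)"
      using i[OF uv(1)] i[OF uv(2)] by auto
    then show "?f u \<noteq> ?f v"
      using disj by (cases b; cases b') auto
  qed
  also have "\<dots> \<le> card (UNIV :: bool set)"
    by (intro card_mono) auto
  finally show ?thesis by simp
qed

theorem corollary4:
  fixes k :: nat
  assumes "k > 0"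
  shows "\<forall>N0::nat. \<exists>N\<ge>N0. N > 0 \<and>
    (\<exists>(T :: (nat, nat \<times> nat) pre_digraph) A B.
      tournament T \<and> card (verts T) = N \<and>
      A \<subseteq> verts T \<and> B \<subseteq> verts T \<and> A \<inter> B = {} \<and>
      chromatic_number (T \<restriction> A) \<ge> k \<and> chromatic_number (T \<restriction> B) \<ge> k \<and>
      (\<forall>A' B'. A' \<subseteq> A \<longrightarrow> B' \<subseteq> B \<longrightarrow>
         real (card A') \<le> ln (real N) / (32 * (real k)\<^sup>2) \<longrightarrow>
         real (card B') \<le> ln (real N) / (32 * (real k)\<^sup>2) \<longrightarrow>
         chromatic_number (T \<restriction> (A \<inter> out_neighbourhood T B')) \<le> 2 \<and>
         chromatic_number (T \<restriction> (B \<inter> out_neighbourhood T A')) \<le> 2))"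
proof
  fix N0 :: nat
  define t where "t = Suc N0"
  define d where "d = 2 * k - 2"
  define s where "s = t * d"
  define n where "n = (2::nat) ^ (2 * s + 3)"
  \<comment> \<open>\<open>t\<close> bounds the size of the sets \<open>A'\<close> and \<open>B'\<close>, and \<open>s\<close> the number of zeros of the at most
    \<open>t\<close> vectors in such a set. The defect \<open>d\<close> makes \<open>d + 2\<close>, the bound on the chromatic number of
    the graph, equal to \<open>2 * k\<close>.\<close>
  define N where "N = (2::nat) ^ (32 * k\<^sup>2 * t)"
  define V where "V = near_alternating n d"
  define M where "M = card V"
  have "k \<le> k\<^sup>2" "0 < k\<^sup>2"
    using assms by (auto simp: power2_eq_square)
  have "3 * d < n"
  proof -
    have "d \<le> s" unfolding s_def t_def by simp
    moreover have "n = 8 * 2 ^ (2 * s)"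
      unfolding n_def by (simp add: power_add)
    ultimately show ?thesis
      using less_exp[of "2 * s"] by linarith
  qed
  have "2 * M \<le> N"
  proof -
    have "M \<le> 2 * (3 * n + 1) ^ d"
      unfolding M_def V_def by (rule card_near_alternating)
    also have "\<dots> \<le> 2 * (2 ^ (2 * s + 5)) ^ d"
    proof (intro mult_left_mono power_mono)
      have "1 \<le> n" unfolding n_def by simp
      moreover have "(2::nat) ^ (2 * s + 5) = 4 * n"
        unfolding n_def by (simp add: power_add)
      ultimately show "3 * n + 1 \<le> 2 ^ (2 * s + 5)" by linarith
    qed auto
    finally have "2 * M \<le> 2 ^ (2 + (2 * s + 5) * d)"
      by (simp add: power_add power_mult)
    moreover have "2 + (2 * s + 5) * d \<le> 32 * k\<^sup>2 * t"
    proof -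
      have "0 < k\<^sup>2 * t"
        using \<open>0 < k\<^sup>2\<close> by (intro mult_pos_pos) (simp_all add: t_def)
      moreover have "d * d \<le> 4 * k\<^sup>2"
        unfolding d_def power2_eq_square using mult_le_mono[of "2 * k - 2" "2 * k" "2 * k - 2" "2 * k"]
        by simp
      then have "s * d \<le> 4 * (k\<^sup>2 * t)"
        unfolding s_def using mult_le_mono2[of "d * d" "4 * k\<^sup>2" t] by (simp add: ac_simps)
      moreover have "d \<le> 2 * (k\<^sup>2 * t)"
      proof -
        have "k\<^sup>2 * 1 \<le> k\<^sup>2 * t" by (intro mult_le_mono2) (simp add: t_def)
        then show ?thesis using \<open>k \<le> k\<^sup>2\<close> unfolding d_def by linarith
      qed
      moreover have "2 + (2 * s + 5) * d = 2 + 2 * (s * d) + 5 * d"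
        by (simp add: algebra_simps)
      ultimately show ?thesis by linarith
    qed
    ultimately show ?thesis
      unfolding N_def by (meson order_trans power_increasing one_le_numeral)
  qed
  have "N0 \<le> N"
  proof -
    have "1 * t \<le> 32 * k\<^sup>2 * t"
      using \<open>0 < k\<^sup>2\<close> by (intro mult_le_mono1) linarith
    also have "\<dots> < N"
      unfolding N_def by (rule less_exp)
    finally show ?thesis
      by (simp add: t_def)
  qed
  have small: "m \<le> t" if "real m \<le> ln (real N) / (32 * (real k)\<^sup>2)" for m
  proof -
    have "ln (real N) = real (32 * k\<^sup>2 * t) * ln 2"
      unfolding N_def by (simp add: ln_realpow)
    also have "\<dots> \<le> real (32 * k\<^sup>2 * t) * 1"
      using ln_le_minus_one[of 2] by (intro mult_left_mono) auto
    finally have "ln (real N) / (32 * (real k)\<^sup>2) \<le> real t"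
      using assms by (simp add: field_simps)
    then show ?thesis using that by linarith
  qed
  have "finite V"
    unfolding V_def by (rule card_near_alternating)
  then obtain x where x: "bij_betw x {..<M} V"
    using ex_bij_betw_nat_finite unfolding M_def lessThan_atLeast0 by blast
  obtain w where rows: "\<And>J. J \<subseteq> {..<n} \<Longrightarrow> card J \<le> s \<Longrightarrow> \<exists>i<n. \<forall>j\<in>J. w i j"
    and cols: "\<And>I. I \<subseteq> {..<n} \<Longrightarrow> card I \<le> s \<Longrightarrow> \<exists>j<n. \<forall>i\<in>I. \<not> w i j"
    by (rule exists_universal_bit_matrix[of s, folded n_def]) blast
  define Z where "Z u = zeros n (x u)" for u
  have Z: "Z u \<subseteq> {..<n}" "i < n \<Longrightarrow> i \<notin> Z u \<Longrightarrow> i \<in> fst ` x u" for u i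
    by (auto simp: Z_def zeros_def)
  have card_Z: "card (\<Union>u\<in>U. Z (f u)) \<le> s"
    if "finite U" "card U \<le> t" "\<And>u. u \<in> U \<Longrightarrow> f u < M" for U and f :: "nat \<Rightarrow> nat"
  proof -
    have "card (Z (f u)) \<le> d" if "u \<in> U" for u
      using bij_betwE[OF x] \<open>\<And>u. u \<in> U \<Longrightarrow> f u < M\<close>[OF that]
      unfolding Z_def V_def by (intro card_zeros_near_alternating) blast
    then have "(\<Sum>u\<in>U. card (Z (f u))) \<le> card U * d"
      using sum_bounded_above[of U "\<lambda>u. card (Z (f u))" d] by simp
    then show ?thesis
      using card_UN_le[OF \<open>finite U\<close>, of "\<lambda>u. Z (f u)"] mult_le_mono1[OF \<open>card U \<le> t\<close>, of d]
      unfolding s_def by linarith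
  qed
  \<comment> \<open>If \<open>i\<close> is a zero of \<open>a\<close> and the row \<open>i\<close> is true on all zeros of \<open>b\<close>, then \<open>a\<close> dominates \<open>b\<close>;
    if \<open>j\<close> is a zero of \<open>b\<close> and the column \<open>j\<close> is false on all zeros of \<open>a\<close>, it does not.\<close>
  define dom where "dom a b \<longleftrightarrow> (\<exists>i\<in>Z a. \<forall>j\<in>Z b. w i j)" for a b
  define E where "E u v \<longleftrightarrow>
    (if v < M then x u \<inter> x v = {}
     else if u < M then \<not> dom u (v - M)
     else x (u - M) \<inter> x (v - M) = {})" for u v
  define T where "T = back_edge_tournament N E"
  define A B where "A = {0..<0 + M}" and "B = {M..<M + M}"
  have EA: "E u v \<longleftrightarrow> x (u - 0) \<inter> x (v - 0) = {}" if "0 \<le> u" "u < v" "v < 0 + M" for u v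
    using that by (simp add: E_def)
  have EB: "E u v \<longleftrightarrow> x (u - M) \<inter> x (v - M) = {}" if "M \<le> u" "u < v" "v < M + M" for u v
    using that by (simp add: E_def)
  have fits: "0 + M \<le> N" "M + M \<le> N"
    using \<open>2 * M \<le> N\<close> by auto
  have "d + 2 = 2 * k"
    using assms by (simp add: d_def)
  then have "k \<le> chromatic_number (T \<restriction> A)" "k \<le> chromatic_number (T \<restriction> B)"
    using near_alternating_back_edge_chromatic_ge[where E = E, OF \<open>3 * d < n\<close> x[unfolded V_def] fits(1) EA]
      near_alternating_back_edge_chromatic_ge[where E = E, OF \<open>3 * d < n\<close> x[unfolded V_def] fits(2) EB]
    unfolding T_def A_def B_def by auto
  moreover have "chromatic_number (T \<restriction> (A \<inter> out_neighbourhood T B')) \<le> 2"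
    if B': "B' \<subseteq> B" and "real (card B') \<le> ln (real N) / (32 * (real k)\<^sup>2)" for B'
  proof -
    have "finite B'" using B' finite_subset unfolding B_def by blast
    moreover have "b - M < M" if "b \<in> B'" for b
      using subsetD[OF B' that] by (auto simp: B_def)
    ultimately have "card (\<Union>b\<in>B'. Z (b - M)) \<le> s"
      using small[OF that(2)] by (intro card_Z)
    moreover have "(\<Union>b\<in>B'. Z (b - M)) \<subseteq> {..<n}"
      using Z(1) by blast
    ultimately obtain i where i: "i < n" "\<forall>b\<in>B'. \<forall>j\<in>Z (b - M). w i j"
      using rows[of "\<Union>b\<in>B'. Z (b - M)"] by auto
    show ?thesis
      unfolding T_def
    proof (rule common_support_chromatic_le_2[where x = x and E = E, OF _ fits(1) EA])
      show "A \<inter> out_neighbourhood (back_edge_tournament N E) B' \<subseteq> {0..<0 + M}"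
        unfolding A_def by blast
      fix a assume a: "a \<in> A \<inter> out_neighbourhood (back_edge_tournament N E) B'"
      then obtain b where b: "b \<in> B'" "(b, a) \<in> arcs_ends (back_edge_tournament N E)"
        unfolding out_neighbourhood_def out_neighbours_def by blast
      have "a < M" "M \<le> b"
        using a b(1) B' by (auto simp: A_def B_def)
      then have "\<not> dom a (b - M)"
        using b(2) by (auto simp: arcs_ends_back_edge_tournament E_def)
      then have "i \<notin> Z a"
        using i(2) b(1) unfolding dom_def by blast
      then show "i \<in> fst ` x (a - 0)"
        using Z(2) i(1) by simp
    qed
  qed
  moreover have "chromatic_number (T \<restriction> (B \<inter> out_neighbourhood T A')) \<le> 2"
    if A': "A' \<subseteq> A" and "real (card A') \<le> ln (real N) / (32 * (real k)\<^sup>2)" for A'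
  proof -
    have "finite A'" using A' finite_subset unfolding A_def by blast
    moreover have "a < M" if "a \<in> A'" for a
      using subsetD[OF A' that] by (simp add: A_def)
    ultimately have "card (\<Union>a\<in>A'. Z a) \<le> s"
      using small[OF that(2)] by (intro card_Z)
    moreover have "(\<Union>a\<in>A'. Z a) \<subseteq> {..<n}"
      using Z(1) by blast
    ultimately obtain j where j: "j < n" "\<forall>a\<in>A'. \<forall>i\<in>Z a. \<not> w i j"
      using cols[of "\<Union>a\<in>A'. Z a"] by auto
    show ?thesis
      unfolding T_def
    proof (rule common_support_chromatic_le_2[where x = x and E = E, OF _ fits(2) EB])
      show "B \<inter> out_neighbourhood (back_edge_tournament N E) A' \<subseteq> {M..<M + M}"
        unfolding B_def by blast
      fix b assume b: "b \<in> B \<inter> out_neighbourhood (back_edge_tournament N E) A'"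
      then obtain a where a: "a \<in> A'" "(a, b) \<in> arcs_ends (back_edge_tournament N E)"
        unfolding out_neighbourhood_def out_neighbours_def by blast
      have "a < M" "M \<le> b"
        using b a(1) A' by (auto simp: A_def B_def)
      then have "dom a (b - M)"
        using a(2) by (auto simp: arcs_ends_back_edge_tournament E_def)
      then have "j \<notin> Z (b - M)"
        using j(2) a(1) unfolding dom_def by blast
      then show "j \<in> fst ` x (b - M)"
        using Z(2) j(1) by simp
    qed
  qed
  moreover have "tournament T" "card (verts T) = N" "A \<subseteq> verts T" "B \<subseteq> verts T" "A \<inter> B = {}"
    using fits tournament_back_edge_tournament by (auto simp: T_def A_def B_def)
  moreover have "N > 0"
    unfolding N_def by simp
  ultimately show "\<exists>N\<ge>N0. N > 0 \<and>
    (\<exists>(T :: (nat, nat \<times> nat) pre_digraph) A B.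
      tournament T \<and> card (verts T) = N \<and>
      A \<subseteq> verts T \<and> B \<subseteq> verts T \<and> A \<inter> B = {} \<and>
      chromatic_number (T \<restriction> A) \<ge> k \<and> chromatic_number (T \<restriction> B) \<ge> k \<and>
      (\<forall>A' B'. A' \<subseteq> A \<longrightarrow> B' \<subseteq> B \<longrightarrow>
         real (card A') \<le> ln (real N) / (32 * (real k)\<^sup>2) \<longrightarrow>
         real (card B') \<le> ln (real N) / (32 * (real k)\<^sup>2) \<longrightarrow>
         chromatic_number (T \<restriction> (A \<inter> out_neighbourhood T B')) \<le> 2 \<and>
         chromatic_number (T \<restriction> (B \<inter> out_neighbourhood T A')) \<le> 2))"
    using \<open>N0 \<le> N\<close>
    by - (intro exI[of _ N] conjI, assumption, assumption, rule exI[of _ T], rule exI[of _ A],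
      rule exI[of _ B], (intro conjI allI impI; (assumption | blast)))
qed

end
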